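(* Let $d\ge1$, $\Xi=\mathbb{R}^d_x\times\mathbb{R}^d_\xi$, $f,g\in\mathcal{S}(\Xi)$ and $0<\varepsilon<1$. Then the Weyl product $f\star g$ can be expanded asymptotically in $\varepsilon$: for every $N\in\mathbb{N}_0$, $$f\star g=\sum_{n=0}^N\varepsilon^n (f\star g)_{(n)}+\varepsilon^{N+1}R_N=\sum_{n=0}^N\varepsilon^n (f\star g)_{(n)}+\mathcal{O}(\varepsilon^{N+1}),$$ where all terms $(f\star g)_{(n)}$ are Schwartz functions on $\Xi$, given explicitly by $$(f\star g)_{(n)}(X)=\frac{1}{n!}\frac{i^n}{2^n}\bigl(\nabla_y\cdot\nabla_\zeta-\nabla_\eta\cdot\nabla_z\bigr)^n f(Y)\,g(Z)\Big|_{Y=X=Z},\qquad Y=(y,\eta),\ Z=(z,\zeta),$$ and the remainder $$R_N(X)=\frac{1}{(2\pi)^{2d}}\int_\Xi dY\int_\Xi dZ\,e^{i\sigma(X,Y+Z)}\,\frac{1}{N!}\frac{i^{N+1}}{2^{N+1}}\bigl(\sigma(Y,Z)\bigr)^{N+1}\left(\int_0^1 ds\,(1-s)^N e^{is\frac{\varepsilon}{2}\sigma(Y,Z)}\right)(\mathcal{F}_\sigma f)(Y)\,(\mathcal{F}_\sigma g)(Z)$$ is also in $\mathcal{S}(\Xi)$. The first two terms are given by $$f\star g=f\,g-\varepsilon\tfrac{i}{2}\{f,g\}+\mathcal{O}(\varepsilon^2).$$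
   Context: For $X=(x,\xi),Y=(y,\eta)\in\Xi$ put $\sigma(X,Y)=\xi\cdot y-x\cdot\eta$ and, for $f\in\mathcal{S}(\Xi)$, $(\mathcal{F}_\sigma f)(X)=(2\pi)^{-d}\int_\Xi dY\,e^{i\sigma(X,Y)}f(Y)$. The Weyl product of $f,g\in\mathcal{S}(\Xi)$ is the Schwartz function $$(f\star g)(X)=\frac{1}{(2\pi)^{2d}}\int_\Xi dY\int_\Xi dZ\,e^{i\sigma(X,Y+Z)}\,e^{i\frac{\varepsilon}{2}\sigma(Y,Z)}\,(\mathcal{F}_\sigma f)(Y)\,(\mathcal{F}_\sigma g)(Z).$$ The Poisson bracket is $\{f,g\}=\sum_{j=1}^d(\partial_{\xi_j}f\,\partial_{x_j}g-\partial_{x_j}f\,\partial_{\xi_j}g)$. The functions $f,g$ do not depend on $\varepsilon$, and $\mathcal{O}(\varepsilon^k)$ is the usual Landau symbol as $\varepsilon\to0$ (at each point $X\in\Xi$). *)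

theory Defs
  imports "HOL-Analysis.Analysis" "HOL-Library.Landau_Symbols"
begin

definition partial_deriv ::
  "'a::euclidean_space \<Rightarrow> ('a \<Rightarrow> complex) \<Rightarrow> 'a \<Rightarrow> complex" where
  "partial_deriv b f x = frechet_derivative f (at x) b"

definition iterated_partial ::
  "'a::euclidean_space list \<Rightarrow> ('a \<Rightarrow> complex) \<Rightarrow> 'a \<Rightarrow> complex" where
  "iterated_partial bs f = foldr partial_deriv bs f"

text \<open>The lists \<open>bs\<close> of standard basis vectors play the role of multi-indices; requiring
  every iterated partial derivative to be totally differentiable is smoothness.\<close>

definition schwartz :: "('a::euclidean_space \<Rightarrow> complex) \<Rightarrow> bool" where
  "schwartz f \<longleftrightarrow>
     (\<forall>bs. set bs \<subseteq> Basis \<longrightarrow>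
        (\<forall>x. iterated_partial bs f differentiable (at x)) \<and>
        (\<forall>k::nat. \<exists>C. \<forall>x. (1 + norm x) ^ k * norm (iterated_partial bs f x) \<le> C))"

text \<open>Points of phase space are pairs \<open>(x, \<xi>)\<close>, position first.\<close>

type_synonym 'd phase_space = "(real ^ 'd) \<times> (real ^ 'd)"

definition sympl :: "'d::finite phase_space \<Rightarrow> 'd phase_space \<Rightarrow> real" where
  "sympl X Y = snd X \<bullet> fst Y - fst X \<bullet> snd Y"

definition sympl_fourier ::
  "('d::finite phase_space \<Rightarrow> complex) \<Rightarrow> 'd phase_space \<Rightarrow> complex" where
  "sympl_fourier f X =
     1 / (2 * of_real pi) ^ CARD('d) *
     (\<integral>Y. exp (\<i> * of_real (sympl X Y)) * f Y \<partial>lborel)"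

definition weyl_prod ::
  "real \<Rightarrow> ('d::finite phase_space \<Rightarrow> complex) \<Rightarrow> ('d phase_space \<Rightarrow> complex)
     \<Rightarrow> 'd phase_space \<Rightarrow> complex" where
  "weyl_prod \<epsilon> f g X =
     1 / (2 * of_real pi) ^ (2 * CARD('d)) *
     (\<integral>Y. (\<integral>Z. exp (\<i> * of_real (sympl X (Y + Z))) *
                 exp (\<i> * of_real (\<epsilon> / 2 * sympl Y Z)) *
                 sympl_fourier f Y * sympl_fourier g Z \<partial>lborel) \<partial>lborel)"

definition poisson_bracket ::
  "('d::finite phase_space \<Rightarrow> complex) \<Rightarrow> ('d phase_space \<Rightarrow> complex)
     \<Rightarrow> 'd phase_space \<Rightarrow> complex" where
  "poisson_bracket f g X =
     (\<Sum>j\<in>UNIV. partial_deriv (0, axis j 1) f X * partial_deriv (axis j 1, 0) g X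
              - partial_deriv (axis j 1, 0) f X * partial_deriv (0, axis j 1) g X)"

text \<open>The operator \<open>\<nabla>\<^sub>y \<cdot> \<nabla>\<^sub>\<zeta> - \<nabla>\<^sub>\<eta> \<cdot> \<nabla>\<^sub>z\<close> on functions of
  \<open>(Y, Z) = ((y, \<eta>), (z, \<zeta>))\<close>.\<close>

definition moyal_op ::
  "('d::finite phase_space \<times> 'd phase_space \<Rightarrow> complex)
     \<Rightarrow> 'd phase_space \<times> 'd phase_space \<Rightarrow> complex" where
  "moyal_op H W =
     (\<Sum>j\<in>UNIV. partial_deriv ((axis j 1, 0), (0, 0))
                  (partial_deriv ((0, 0), (0, axis j 1)) H) W)
   - (\<Sum>j\<in>UNIV. partial_deriv ((0, axis j 1), (0, 0))
                  (partial_deriv ((0, 0), (axis j 1, 0)) H) W)"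

definition weyl_term ::
  "nat \<Rightarrow> ('d::finite phase_space \<Rightarrow> complex) \<Rightarrow> ('d phase_space \<Rightarrow> complex)
     \<Rightarrow> 'd phase_space \<Rightarrow> complex" where
  "weyl_term n f g X =
     1 / fact n * (\<i> ^ n / 2 ^ n) * (moyal_op ^^ n) (\<lambda>(Y, Z). f Y * g Z) (X, X)"

definition weyl_remainder ::
  "real \<Rightarrow> nat \<Rightarrow> ('d::finite phase_space \<Rightarrow> complex) \<Rightarrow> ('d phase_space \<Rightarrow> complex)
     \<Rightarrow> 'd phase_space \<Rightarrow> complex" where
  "weyl_remainder \<epsilon> N f g X =
     1 / (2 * of_real pi) ^ (2 * CARD('d)) *
     (\<integral>Y. (\<integral>Z. exp (\<i> * of_real (sympl X (Y + Z))) *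
                 (1 / fact N * (\<i> ^ (N + 1) / 2 ^ (N + 1))) *
                 of_real (sympl Y Z) ^ (N + 1) *
                 (LBINT s:{0..1}. of_real ((1 - s) ^ N) *
                    exp (\<i> * of_real (s * (\<epsilon> / 2) * sympl Y Z))) *
                 sympl_fourier f Y * sympl_fourier g Z \<partial>lborel) \<partial>lborel)"

end

theory Submission
  imports Defs "HOL-Probability.Sinc_Integral" "HOL-Probability.Characteristic_Functions"
begin

text \<open>
  Let \<open>K(Y, Z) = (2\<pi>)\<^sup>-\<^sup>2\<^sup>d (F\<^sub>\<sigma> f)(Y) (F\<^sub>\<sigma> g)(Z)\<close>. By Fourier inversion
  \<open>f(Y') g(Z')\<close> is the double integral of \<open>K\<close> against \<open>exp(i \<sigma>(Y', Y) + i \<sigma>(Z', Z))\<close>, and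
  differentiating under the integral turns the bidifferential operator into multiplication of
  \<open>K\<close> by \<open>\<sigma>(Y, Z)\<close>. Taylor's formula for \<open>exp(i \<epsilon> \<sigma>(Y, Z) / 2)\<close> with integral remainder,
  integrated against \<open>K\<close>, is therefore the expansion, and the remainder is bounded uniformly
  in \<open>\<epsilon>\<close> because \<open>K\<close> has finite moments. Only decay of \<open>F\<^sub>\<sigma> f\<close> and \<open>F\<^sub>\<sigma> g\<close> is needed, not their smoothness.

  Carrying out the \<open>Z\<close>-integral by inversion gives
  \<open>(f \<star> g)(X) = (2\<pi>)\<^sup>-\<^sup>d \<integral> exp(i \<sigma>(X, Y)) (F\<^sub>\<sigma> f)(Y) g(X + \<epsilon> Y / 2) dY\<close>, which is visibly a
  Schwartz function of \<open>X\<close>. Then \<open>R\<^sub>N\<close> is one as well, since \<open>\<epsilon>\<^sup>N\<^sup>+\<^sup>1 R\<^sub>N\<close> is a difference of Schwartz functions.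
\<close>

section \<open>Integration over Euclidean space\<close>

text \<open>In the double integral \<open>weyl_prod\<close>, \<open>X\<close> occurs only in an
  oscillating factor, so decay in \<open>X\<close> read off from it would cost derivatives of the
  transforms. After the \<open>Z\<close>-integral the twist
  \<open>iexp (\<epsilon> / 2 * sympl Y Z)\<close> has become a translation of \<open>g\<close>, and
  \<open>g\<close> itself supplies the decay: \<open>1 + norm X\<close> is at most
  \<open>(1 + norm (X + (\<epsilon> / 2) *\<^sub>R Y)) * (1 + norm Y)\<close> as soon as
  \<open>\<bar>\<epsilon>\<bar> \<le> 2\<close>, and \<open>sympl_fourier f\<close> pays for the
  powers of the last factor. Dividing a difference of Schwartz functions by a power of
  \<open>\<epsilon>\<close> says nothing about small \<open>\<epsilon>\<close>. The Landau estimate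
  therefore has a separate source, the scalar inequality \<open>norm (taylor_remainder \<epsilon> N
  t) \<le> \<bar>t\<bar> ^ (N + 1)\<close>, in which \<open>\<epsilon>\<close> has cancelled. Two
  signs make the formulas close up. As \<sigma> is skew, the transform is its own inverse, without a
  reflection. And each term of the bidifferential operator takes two derivatives of a wave, one of
  which brings a minus sign from \<sigma>; this absorbs \<open>\<i> * \<i>\<close>, and the
  multiplier is exactly \<sigma>(Y, Z).\<close>

lemma measurable_basis_sum:
  "(\<lambda>x. \<Sum>b\<in>Basis. x b *\<^sub>R b) \<in> (\<Pi>\<^sub>M b\<in>(Basis::'a::euclidean_space set). lborel) \<rightarrow>\<^sub>M borel"
  by measurable

text \<open>By \<open>lborel_eq\<close>, Lebesgue measure is the image of a product of
  one-dimensional Lebesgue measures under the map of \<open>measurable_basis_sum\<close>, so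
  coordinatewise products integrate factor by factor. Both the integrable weights and the Gaussians
  below have this form.\<close>

lemma
  fixes h :: "'a::euclidean_space \<Rightarrow> real \<Rightarrow> 'c::{real_normed_field, banach, second_countable_topology}"
  assumes h: "\<And>b. b \<in> Basis \<Longrightarrow> integrable lborel (h b)"
  shows integrable_lborel_prod: "integrable lborel (\<lambda>x. \<Prod>b\<in>Basis. h b (x \<bullet> b))" (is ?int)
    and integral_lborel_prod:
      "(\<integral>x. (\<Prod>b\<in>Basis. h b (x \<bullet> b)) \<partial>lborel) = (\<Prod>b\<in>Basis. \<integral>t. h b t \<partial>lborel)" (is ?eq)
proof -
  interpret product_sigma_finite "\<lambda>_::'a. lborel :: real measure" ..
  let ?P = "\<lambda>x::'a \<Rightarrow> real. \<Prod>b\<in>Basis. h b (x b)"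
  have [measurable]: "h b \<in> borel_measurable borel" if "b \<in> Basis" for b
    using borel_measurable_integrable[OF h[OF that]] by simp
  have meas: "(\<lambda>x. \<Prod>b\<in>Basis. h b (x \<bullet> b)) \<in> borel_measurable borel"
    by measurable
  have eq: "(\<Prod>b\<in>Basis. h b ((\<Sum>c\<in>Basis. x c *\<^sub>R c) \<bullet> b)) = ?P x" for x
    by (intro prod.cong refl) (simp add: inner_sum_left inner_Basis if_distrib cong: if_cong)
  have P: "integrable (\<Pi>\<^sub>M b\<in>Basis. lborel) ?P"
    by (rule product_integrable_prod) (use h in auto)
  show ?int
    by (subst lborel_eq) (simp add: integrable_distr_eq[OF measurable_basis_sum meas] eq P)
  show ?eq
    by (subst lborel_eq)
       (simp add: integral_distr[OF measurable_basis_sum meas] eq product_integral_prod[OF finite_Basis h])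
qed

lemma
  fixes f :: "'a::euclidean_space \<Rightarrow> 'c::{banach, second_countable_topology}"
  assumes f: "f \<in> borel_measurable borel" and c: "c \<noteq> 0"
  shows integrable_lborel_affine: "integrable lborel (\<lambda>x. f (t + c *\<^sub>R x)) \<longleftrightarrow> integrable lborel f" (is ?int)
    and integral_lborel_affine:
      "(\<integral>x. f x \<partial>lborel) = \<bar>c\<bar> ^ DIM('a) *\<^sub>R (\<integral>x. f (t + c *\<^sub>R x) \<partial>lborel)" (is ?eq)
proof -
  let ?T = "\<lambda>x::'a. t + c *\<^sub>R x"
  have T: "?T \<in> lborel \<rightarrow>\<^sub>M borel" by measurable
  have f': "f \<in> borel_measurable (distr lborel borel ?T)" using f by simp
  have m: "(\<lambda>x::'a. \<bar>c\<bar> ^ DIM('a)) \<in> borel_measurable (distr lborel borel ?T)" by simp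
  have L: "lborel = density (distr lborel borel ?T) (\<lambda>_. ennreal (\<bar>c\<bar> ^ DIM('a)))"
    using lborel_affine[OF c, of t] .
  have scale: "integrable N (\<lambda>x. \<bar>c\<bar> ^ DIM('a) *\<^sub>R f x) \<longleftrightarrow> integrable N f" for N :: "'a measure"
  proof
    assume "integrable N (\<lambda>x. \<bar>c\<bar> ^ DIM('a) *\<^sub>R f x)"
    then have "integrable N (\<lambda>x. inverse (\<bar>c\<bar> ^ DIM('a)) *\<^sub>R \<bar>c\<bar> ^ DIM('a) *\<^sub>R f x)"
      by (rule integrable_scaleR_right)
    then show "integrable N f" using c by simp
  qed simp
  show ?int
    by (subst (2) L, subst integrable_density[OF f' m]) (simp_all add: integrable_distr_eq[OF T f] scale)
  show ?eq
    by (subst L, subst integral_density[OF f' m]) (auto simp: integral_distr[OF T f])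
qed

lemma integrable_inverse_one_plus_square: "integrable lborel (\<lambda>t::real. inverse (1 + t\<^sup>2))"
  using integrable_inverse_1_plus_square by (simp add: set_integrable_def)

text \<open>Origin of the exponent \<open>2 * DIM('a)\<close>: each one-dimensional weight
  \<open>1 + t\<^sup>2\<close>, whose inverse is integrable, costs two powers of
  \<open>1 + norm x\<close>.\<close>

lemma prod_Basis_le_norm:
  fixes x :: "'a::euclidean_space"
  shows "(\<Prod>b\<in>(Basis::'a set). 1 + (x \<bullet> b)\<^sup>2) \<le> (1 + norm x) ^ (2 * DIM('a))"
proof -
  have "1 + (x \<bullet> b)\<^sup>2 \<le> (1 + norm x)\<^sup>2" if "b \<in> Basis" for b :: 'a
  proof -
    have "(x \<bullet> b)\<^sup>2 \<le> (norm x)\<^sup>2"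
      using Basis_le_norm[OF that, of x] by (simp add: abs_le_square_iff[symmetric])
    moreover have "0 \<le> 2 * norm x" by simp
    ultimately show ?thesis unfolding power2_sum one_power2 by linarith
  qed
  then have "(\<Prod>b\<in>(Basis::'a set). 1 + (x \<bullet> b)\<^sup>2) \<le> (\<Prod>b\<in>(Basis::'a set). (1 + norm x)\<^sup>2)"
    by (intro prod_mono) auto
  then show ?thesis by (simp add: power_mult)
qed

lemma integrable_inverse_power_norm:
  "integrable lborel (\<lambda>x::'a::euclidean_space. inverse ((1 + norm x) ^ (2 * DIM('a))))"
proof (rule Bochner_Integration.integrable_bound)
  show "integrable lborel (\<lambda>x::'a. \<Prod>b\<in>Basis. inverse (1 + (x \<bullet> b)\<^sup>2))"
    by (rule integrable_lborel_prod) (rule integrable_inverse_one_plus_square)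
  show "AE x in lborel. norm (inverse ((1 + norm (x::'a)) ^ (2 * DIM('a))))
      \<le> norm (\<Prod>b\<in>Basis. inverse (1 + (x \<bullet> b)\<^sup>2))"
  proof (rule AE_I2)
    fix x :: 'a
    have "0 < (\<Prod>b\<in>(Basis::'a set). 1 + (x \<bullet> b)\<^sup>2)"
      by (intro prod_pos) (auto intro: add_pos_nonneg)
    then show "norm (inverse ((1 + norm (x::'a)) ^ (2 * DIM('a))))
      \<le> norm (\<Prod>b\<in>Basis. inverse (1 + (x \<bullet> b)\<^sup>2))"
      using le_imp_inverse_le[OF prod_Basis_le_norm[of x]]
      by (simp add: prod_inversef[unfolded o_def])
  qed
qed simp

text \<open>Up to the normalisation \<open>sqrt (2 * pi)\<close> of the density, this is the
  characteristic function of the standard normal distribution.\<close>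

lemma
  shows integrable_real_gaussian_wave:
      "integrable lborel (\<lambda>t. iexp (s * t) * of_real (exp (- t\<^sup>2 / 2)))" (is ?int)
    and integral_real_gaussian_wave:
      "(\<integral>t. iexp (s * t) * of_real (exp (- t\<^sup>2 / 2)) \<partial>lborel) = sqrt (2 * pi) * exp (- s\<^sup>2 / 2)" (is ?eq)
proof -
  have eq: "iexp (s * t) * of_real (exp (- t\<^sup>2 / 2)) = sqrt (2 * pi) * (std_normal_density t *\<^sub>R iexp (s * t))" for t
    by (simp add: std_normal_density_def scaleR_conv_of_real)
  have "integrable lborel (\<lambda>t. std_normal_density t *\<^sub>R iexp (s * t))"
    by (rule Bochner_Integration.integrable_bound[OF integrable_normal_density[of 1 0]])
       (auto simp: normal_density_nonneg)
  then show ?int unfolding eq by (rule integrable_mult_right)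
  have "(\<integral>t. std_normal_density t *\<^sub>R iexp (s * t) \<partial>lborel) = char std_normal_distribution s"
    unfolding char_def
    by (subst integral_density) (auto simp: normal_density_nonneg)
  then show ?eq unfolding eq integral_mult_right_zero by (simp add: char_std_normal_distribution)
qed

lemma
  fixes u :: "'a::euclidean_space"
  shows integrable_gaussian_wave:
      "integrable lborel (\<lambda>x. iexp (u \<bullet> x) * of_real (exp (- (norm x)\<^sup>2 / 2)))" (is ?int)
    and integral_gaussian_wave:
      "(\<integral>x. iexp (u \<bullet> x) * of_real (exp (- (norm x)\<^sup>2 / 2)) \<partial>lborel)
        = sqrt (2 * pi) ^ DIM('a) * exp (- (norm u)\<^sup>2 / 2)" (is ?eq)
proof -
  have norm2: "(norm x)\<^sup>2 = (\<Sum>b\<in>Basis. (x \<bullet> b)\<^sup>2)" for x :: 'a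
    by (subst power2_norm_eq_inner, subst euclidean_inner) (simp add: power2_eq_square)
  have e: "exp (- (norm x)\<^sup>2 / 2) = (\<Prod>b\<in>Basis. exp (- (x \<bullet> b)\<^sup>2 / 2))" for x :: 'a
    by (simp add: exp_sum[symmetric] norm2 sum_negf sum_divide_distrib)
  have i: "iexp (u \<bullet> x) = (\<Prod>b\<in>Basis. iexp ((u \<bullet> b) * (x \<bullet> b)))" for x :: 'a
    by (simp add: exp_sum[symmetric] euclidean_inner[of u x] sum_distrib_left)
  have eq: "iexp (u \<bullet> x) * of_real (exp (- (norm x)\<^sup>2 / 2))
      = (\<Prod>b\<in>Basis. iexp ((u \<bullet> b) * (x \<bullet> b)) * of_real (exp (- (x \<bullet> b)\<^sup>2 / 2)))" for x :: 'a
    unfolding e i by (simp add: prod.distrib)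
  show ?int
    unfolding eq by (rule integrable_lborel_prod) (rule integrable_real_gaussian_wave)
  show ?eq
    unfolding eq
    by (subst integral_lborel_prod[OF integrable_real_gaussian_wave], unfold integral_real_gaussian_wave)
       (simp only: e of_real_prod of_real_mult prod.distrib prod_constant of_real_power)
qed

section \<open>Differentiation under the integral sign\<close>

text \<open>The majorant \<open>B\<close> has to serve for all \<open>x\<close> at once. In return
  the mean value inequality controls every difference quotient globally, and dominated convergence
  applies to the error of the linear approximation.\<close>

lemma has_derivative_integral:
  fixes k :: "'a::{real_normed_vector, perfect_space} \<Rightarrow> 'b \<Rightarrow> 'c::{banach, second_countable_topology}"
  assumes int: "\<And>x. integrable M (k x)"
    and deriv: "\<And>x y. y \<in> space M \<Longrightarrow> ((\<lambda>x. k x y) has_derivative k' x y) (at x)"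
    and meas: "\<And>x h. (\<lambda>y. k' x y h) \<in> borel_measurable M"
    and bound: "\<And>x y h. y \<in> space M \<Longrightarrow> norm (k' x y h) \<le> B y * norm h"
    and B: "integrable M B"
  shows "((\<lambda>x. \<integral>y. k x y \<partial>M) has_derivative (\<lambda>h. \<integral>y. k' x y h \<partial>M)) (at x)"
proof -
  have intB: "integrable M (\<lambda>y. B y * norm h)" for h :: 'a
    using B by simp
  have int': "integrable M (\<lambda>y. k' x y h)" for x h
    by (rule Bochner_Integration.integrable_bound[OF intB[of h] meas])
       (auto intro!: AE_I2 order_trans[OF bound])
  have lin: "linear (k' x y)" if "y \<in> space M" for x y
    using deriv[OF that] has_derivative_bounded_linear bounded_linear.linear by blast
  have blin: "bounded_linear (\<lambda>h. \<integral>y. k' x y h \<partial>M)"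
  proof (rule bounded_linear_intro[where K = "integral\<^sup>L M B"])
    show "(\<integral>y. k' x y (h1 + h2) \<partial>M) = (\<integral>y. k' x y h1 \<partial>M) + (\<integral>y. k' x y h2 \<partial>M)" for h1 h2
      by (subst Bochner_Integration.integral_add[symmetric, OF int' int'])
         (auto intro!: Bochner_Integration.integral_cong simp: linear_add[OF lin])
    show "(\<integral>y. k' x y (r *\<^sub>R h) \<partial>M) = r *\<^sub>R (\<integral>y. k' x y h \<partial>M)" for r h
    proof -
      have "(\<integral>y. k' x y (r *\<^sub>R h) \<partial>M) = (\<integral>y. r *\<^sub>R k' x y h \<partial>M)"
        by (intro Bochner_Integration.integral_cong) (auto simp: linear_cmul[OF lin])
      then show ?thesis by simp
    qed
    show "norm (\<integral>y. k' x y h \<partial>M) \<le> norm h * integral\<^sup>L M B" for h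
    proof -
      have "norm (\<integral>y. k' x y h \<partial>M) \<le> (\<integral>y. norm (k' x y h) \<partial>M)"
        by (rule integral_norm_bound)
      also have "\<dots> \<le> (\<integral>y. B y * norm h \<partial>M)"
        by (intro integral_mono bound intB integrable_norm int')
      finally show ?thesis by (simp add: mult.commute)
    qed
  qed
  \<comment> \<open>\<open>B y\<close> bounds the derivative everywhere, so it is a global Lipschitz
    constant of the integrand. The increment and its linear part each contribute one
    \<open>B y\<close> to the majorant \<open>2 * B y\<close> below.\<close>
  have lip: "norm (k z y - k x y) \<le> B y * norm (z - x)" if "y \<in> space M" for x y z
  proof (rule differentiable_bound[OF convex_UNIV])
    show "((\<lambda>x. k x y) has_derivative k' w y) (at w within UNIV)" for w
      using deriv[OF that] by simp
    show "onorm (k' w y) \<le> B y" for w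
      by (rule onorm_le) (use bound[OF that] in simp)
  qed auto
  have "((\<lambda>z. norm ((\<integral>y. k z y \<partial>M) - (\<integral>y. k x y \<partial>M) - (\<integral>y. k' x y (z - x) \<partial>M)) / norm (z - x)) \<longlongrightarrow> 0) (at x)"
    \<comment> \<open>The limit is tested along sequences because dominated convergence is a
      statement about sequences.\<close>
    unfolding tendsto_at_iff_sequentially comp_def
  proof (intro allI impI)
    fix Z :: "nat \<Rightarrow> 'a"
    assume Z: "\<forall>i. Z i \<in> UNIV - {x}" and lim: "Z \<longlonglongrightarrow> x"
    let ?q = "\<lambda>i y. (k (Z i) y - k x y - k' x y (Z i - x)) /\<^sub>R norm (Z i - x)"
    have "(\<lambda>i. \<integral>y. ?q i y \<partial>M) \<longlonglongrightarrow> (\<integral>y. 0 \<partial>M)"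
    proof (rule integral_dominated_convergence)
      show "integrable M (\<lambda>y. 2 * B y)" using B by simp
      show "?q i \<in> borel_measurable M" for i
        using borel_measurable_integrable[OF int] meas by measurable
      show "AE y in M. (\<lambda>i. ?q i y) \<longlonglongrightarrow> 0"
      proof (rule AE_I2)
        fix y assume y: "y \<in> space M"
        have "((\<lambda>z. norm (k z y - k x y - k' x y (z - x)) / norm (z - x)) \<longlongrightarrow> 0) (at x)"
          using deriv[OF y, of x] by (simp add: has_derivative_iff_norm)
        then have "(\<lambda>i. norm (k (Z i) y - k x y - k' x y (Z i - x)) / norm (Z i - x)) \<longlonglongrightarrow> 0"
          using Z lim by (auto simp: tendsto_at_iff_sequentially comp_def)
        then show "(\<lambda>i. ?q i y) \<longlonglongrightarrow> 0"
          by (subst tendsto_norm_zero_iff[symmetric]) (simp add: divide_inverse mult.commute)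
      qed
      show "AE y in M. norm (?q i y) \<le> 2 * B y" for i
      proof (rule AE_I2)
        fix y assume y: "y \<in> space M"
        have nz: "norm (Z i - x) > 0" using Z by simp
        have "norm (k (Z i) y - k x y - k' x y (Z i - x)) \<le> B y * norm (Z i - x) + B y * norm (Z i - x)"
          by (intro order_trans[OF norm_triangle_ineq4] add_mono lip bound y)
        then have "norm (k (Z i) y - k x y - k' x y (Z i - x)) / norm (Z i - x) \<le> 2 * B y"
          unfolding pos_divide_le_eq[OF nz] by simp
        then show "norm (?q i y) \<le> 2 * B y"
          by (simp add: divide_inverse mult.commute)
      qed
    qed simp
    moreover have "norm (\<integral>y. ?q i y \<partial>M)
       = norm ((\<integral>y. k (Z i) y \<partial>M) - (\<integral>y. k x y \<partial>M) - (\<integral>y. k' x y (Z i - x) \<partial>M)) / norm (Z i - x)" for i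
      using int int' by (simp add: divide_inverse mult.commute)
    ultimately show "(\<lambda>i. norm ((\<integral>y. k (Z i) y \<partial>M) - (\<integral>y. k x y \<partial>M) - (\<integral>y. k' x y (Z i - x) \<partial>M)) / norm (Z i - x)) \<longlonglongrightarrow> 0"
      using tendsto_norm_zero by fastforce
  qed
  with blin show ?thesis by (simp add: has_derivative_iff_norm)
qed

section \<open>Schwartz functions and rapidly decaying kernels\<close>

lemma partial_deriv_eq: "(f has_derivative f') (at x) \<Longrightarrow> partial_deriv b f x = f' b"
  unfolding partial_deriv_def by (simp add: frechet_derivative_at[symmetric])

text \<open>Replaces the quantification over lists of derivatives by an invariant: it suffices to
  find a class of differentiable, rapidly decaying functions that is stable under
  \<open>partial_deriv b\<close>. Each closure property below consists in choosing that
  class.\<close>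

lemma schwartz_coinduct:
  assumes "P f"
    and "\<And>f x. P f \<Longrightarrow> f differentiable (at x)"
    and "\<And>f k. P f \<Longrightarrow> \<exists>C. \<forall>x. (1 + norm x) ^ k * norm (f x) \<le> C"
    and "\<And>f b. P f \<Longrightarrow> b \<in> Basis \<Longrightarrow> P (partial_deriv b f)"
  shows "schwartz f"
proof -
  have "P (iterated_partial bs f)" if "set bs \<subseteq> Basis" for bs
    using that by (induction bs) (auto simp: iterated_partial_def intro: assms)
  then show ?thesis unfolding schwartz_def using assms(2,3) by blast
qed

lemma schwartz_differentiable: "schwartz f \<Longrightarrow> f differentiable (at x)"
  unfolding schwartz_def iterated_partial_def by (metis empty_set empty_subsetI foldr_Nil id_apply)

lemma schwartz_decay: "schwartz f \<Longrightarrow> \<exists>C. \<forall>x. (1 + norm x) ^ k * norm (f x) \<le> C"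
  unfolding schwartz_def iterated_partial_def by (metis empty_set empty_subsetI foldr_Nil id_apply)

lemma schwartz_partial_deriv:
  assumes "schwartz f" and "b \<in> Basis"
  shows "schwartz (partial_deriv b f)"
proof -
  have "iterated_partial bs (partial_deriv b f) = iterated_partial (bs @ [b]) f" for bs
    by (simp add: iterated_partial_def)
  moreover have "set bs \<subseteq> Basis \<Longrightarrow> set (bs @ [b]) \<subseteq> Basis" for bs
    using assms by simp
  ultimately show ?thesis using assms(1) unfolding schwartz_def by metis
qed

lemma schwartz_bounded: "schwartz f \<Longrightarrow> \<exists>C\<ge>0. \<forall>x. norm (f x) \<le> C"
  using schwartz_decay[of f 0] by (auto intro: order_trans[OF norm_ge_zero])

lemma schwartz_continuous: "schwartz f \<Longrightarrow> continuous_on S f"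
  by (meson continuous_at_imp_continuous_on differentiable_imp_continuous_within schwartz_differentiable)

lemma schwartz_borel_measurable: "schwartz f \<Longrightarrow> f \<in> borel_measurable borel"
  by (intro borel_measurable_continuous_onI schwartz_continuous)

lemma has_derivative_partial_derivs:
  fixes f :: "'a::euclidean_space \<Rightarrow> complex"
  assumes "f differentiable (at x)"
  shows "(f has_derivative (\<lambda>h. \<Sum>b\<in>Basis. (h \<bullet> b) *\<^sub>R partial_deriv b f x)) (at x)"
proof -
  obtain f' where f': "(f has_derivative f') (at x)"
    using assms by (auto simp: differentiable_def)
  then interpret f': bounded_linear f' by (rule has_derivative_bounded_linear)
  have "f' h = (\<Sum>b\<in>Basis. (h \<bullet> b) *\<^sub>R f' b)" for h
  proof -
    have "f' h = f' (\<Sum>b\<in>Basis. (h \<bullet> b) *\<^sub>R b)" by (simp only: euclidean_representation)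
    also have "\<dots> = (\<Sum>b\<in>Basis. (h \<bullet> b) *\<^sub>R f' b)" by (simp only: f'.sum f'.scaleR)
    finally show ?thesis .
  qed
  then have "f' = (\<lambda>h. \<Sum>b\<in>Basis. (h \<bullet> b) *\<^sub>R partial_deriv b f x)"
    unfolding partial_deriv_eq[OF f'] by blast
  with f' show ?thesis by simp
qed

lemma partial_deriv_add:
  assumes "\<And>x. f differentiable (at x)" and "\<And>x. g differentiable (at x)"
  shows "partial_deriv b (\<lambda>x. f x + g x) = (\<lambda>x. partial_deriv b f x + partial_deriv b g x)"
proof
  fix x
  show "partial_deriv b (\<lambda>x. f x + g x) x = partial_deriv b f x + partial_deriv b g x"
    using has_derivative_add[OF assms[of x, unfolded frechet_derivative_works]]
    by (subst partial_deriv_eq) (auto simp: partial_deriv_def)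
qed

lemma partial_deriv_mult:
  fixes f g :: "'a::euclidean_space \<Rightarrow> complex"
  assumes "\<And>x. f differentiable (at x)" and "\<And>x. g differentiable (at x)"
  shows "partial_deriv b (\<lambda>x. f x * g x) = (\<lambda>x. partial_deriv b f x * g x + f x * partial_deriv b g x)"
proof
  fix x
  show "partial_deriv b (\<lambda>x. f x * g x) x = partial_deriv b f x * g x + f x * partial_deriv b g x"
    using has_derivative_mult[OF assms[of x, unfolded frechet_derivative_works]]
    by (subst partial_deriv_eq) (auto simp: partial_deriv_def add.commute)
qed

lemma partial_deriv_cmult:
  assumes "\<And>x. f differentiable (at x)"
  shows "partial_deriv b (\<lambda>x. c * f x) = (\<lambda>x. c * partial_deriv b f x)"
proof
  fix x
  show "partial_deriv b (\<lambda>x. c * f x) x = c * partial_deriv b f x"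
    using has_derivative_mult_right[OF assms[of x, unfolded frechet_derivative_works], of c]
    by (subst partial_deriv_eq) (auto simp: partial_deriv_def)
qed

lemma decay_add:
  fixes f g :: "'a::euclidean_space \<Rightarrow> complex"
  assumes "\<exists>C. \<forall>x. (1 + norm x) ^ k * norm (f x) \<le> C"
    and "\<exists>C. \<forall>x. (1 + norm x) ^ k * norm (g x) \<le> C"
  shows "\<exists>C. \<forall>x. (1 + norm x) ^ k * norm (f x + g x) \<le> C"
proof -
  obtain C D where C: "\<And>x. (1 + norm x) ^ k * norm (f x) \<le> C" and D: "\<And>x. (1 + norm x) ^ k * norm (g x) \<le> D"
    using assms by blast
  have "(1 + norm x) ^ k * norm (f x + g x) \<le> C + D" for x
  proof -
    have "(1 + norm x) ^ k * norm (f x + g x) \<le> (1 + norm x) ^ k * (norm (f x) + norm (g x))"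
      by (intro mult_left_mono norm_triangle_ineq) simp
    with C[of x] D[of x] show ?thesis by (simp add: distrib_left)
  qed
  then show ?thesis by blast
qed

lemma schwartz_add:
  fixes f g :: "'a::euclidean_space \<Rightarrow> complex"
  assumes "schwartz f" and "schwartz g"
  shows "schwartz (\<lambda>x. f x + g x)"
proof (rule schwartz_coinduct)
  let ?P = "\<lambda>h :: 'a \<Rightarrow> complex. \<exists>f g. schwartz f \<and> schwartz g \<and> h = (\<lambda>x. f x + g x)"
  show "?P (\<lambda>x. f x + g x)" using assms by blast
  show "h differentiable (at x)" if "?P h" for h x
    using that schwartz_differentiable by (auto intro!: differentiable_add)
  show "\<exists>C. \<forall>x. (1 + norm x) ^ k * norm (h x) \<le> C" if h: "?P h" for h k
  proof -
    from h obtain f g where fg: "schwartz f" "schwartz g" and h: "h = (\<lambda>x. f x + g x)" by blast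
    show ?thesis unfolding h by (intro decay_add schwartz_decay fg)
  qed
  show "?P (partial_deriv b h)" if "?P h" "b \<in> Basis" for h b
  proof -
    from that(1) obtain f g where fg: "schwartz f" "schwartz g" and h: "h = (\<lambda>x. f x + g x)" by blast
    have "partial_deriv b h = (\<lambda>x. partial_deriv b f x + partial_deriv b g x)"
      unfolding h by (intro partial_deriv_add schwartz_differentiable fg)
    with schwartz_partial_deriv[OF fg(1) that(2)] schwartz_partial_deriv[OF fg(2) that(2)]
    show ?thesis by blast
  qed
qed

lemma schwartz_cmult:
  fixes f :: "'a::euclidean_space \<Rightarrow> complex"
  assumes "schwartz f"
  shows "schwartz (\<lambda>x. c * f x)"
proof (rule schwartz_coinduct)
  let ?P = "\<lambda>h :: 'a \<Rightarrow> complex. \<exists>f. schwartz f \<and> h = (\<lambda>x. c * f x)"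
  show "?P (\<lambda>x. c * f x)" using assms by blast
  show "h differentiable (at x)" if "?P h" for h x
    using that schwartz_differentiable by (auto intro!: differentiable_mult)
  show "\<exists>C. \<forall>x. (1 + norm x) ^ k * norm (h x) \<le> C" if h: "?P h" for h k
  proof -
    from h obtain f where f: "schwartz f" "h = (\<lambda>x. c * f x)" by blast
    obtain C where C: "\<And>x. (1 + norm x) ^ k * norm (f x) \<le> C"
      using schwartz_decay[OF f(1)] by blast
    have "(1 + norm x) ^ k * norm (h x) \<le> norm c * C" for x
      using mult_left_mono[OF C[of x], of "norm c"] by (simp add: f(2) norm_mult mult_ac)
    then show ?thesis by blast
  qed
  show "?P (partial_deriv b h)" if "?P h" and b: "b \<in> Basis" for h b
  proof -
    from that(1) obtain f where f: "schwartz f" and h: "h = (\<lambda>x. c * f x)" by blast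
    have "partial_deriv b h = (\<lambda>x. c * partial_deriv b f x)"
      unfolding h by (intro partial_deriv_cmult schwartz_differentiable f)
    with schwartz_partial_deriv[OF f b] show ?thesis by blast
  qed
qed

lemma schwartz_zero: "schwartz (\<lambda>x::'a::euclidean_space. 0)"
proof (rule schwartz_coinduct)
  let ?P = "\<lambda>h :: 'a \<Rightarrow> complex. h = (\<lambda>x. 0)"
  show "?P (partial_deriv b h)" if "?P h" for h b
    using that by (auto simp: partial_deriv_def)
qed auto

lemma schwartz_sum:
  fixes f :: "'i \<Rightarrow> 'a::euclidean_space \<Rightarrow> complex"
  assumes "\<And>i. i \<in> I \<Longrightarrow> schwartz (f i)"
  shows "schwartz (\<lambda>x. \<Sum>i\<in>I. f i x)"
  using assms by (induction I rule: infinite_finite_induct) (auto intro: schwartz_zero schwartz_add)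

text \<open>The Leibniz rule leads from one product to a sum of two, so single products are not
  stable under differentiation; their finite sums are.\<close>

inductive schwartz_product_sum :: "('a::euclidean_space \<Rightarrow> complex) \<Rightarrow> bool" where
  product: "schwartz f \<Longrightarrow> schwartz g \<Longrightarrow> schwartz_product_sum (\<lambda>x. f x * g x)"
| sum: "schwartz_product_sum f \<Longrightarrow> schwartz_product_sum g \<Longrightarrow> schwartz_product_sum (\<lambda>x. f x + g x)"

lemma schwartz_product_sum_differentiable: "schwartz_product_sum f \<Longrightarrow> f differentiable (at x)"
  by (induction rule: schwartz_product_sum.induct)
     (auto intro: differentiable_add differentiable_mult schwartz_differentiable)

lemma decay_mult_bounded:
  fixes f g :: "'a::euclidean_space \<Rightarrow> complex"
  assumes f: "\<exists>C. \<forall>x. (1 + norm x) ^ k * norm (f x) \<le> C" and g: "\<exists>D\<ge>0. \<forall>x. norm (g x) \<le> D"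
  shows "\<exists>C. \<forall>x. (1 + norm x) ^ k * norm (f x * g x) \<le> C"
proof -
  obtain C D where C: "\<And>x. (1 + norm x) ^ k * norm (f x) \<le> C" and D: "\<And>x. norm (g x) \<le> D" and D0: "D \<ge> 0"
    using f g by blast
  have "(1 + norm x) ^ k * norm (f x * g x) \<le> C * D" for x
  proof -
    have "((1 + norm x) ^ k * norm (f x)) * norm (g x) \<le> C * norm (g x)"
      by (intro mult_right_mono C) simp
    also have "\<dots> \<le> C * D"
      by (intro mult_left_mono D order_trans[OF _ C[of x]]) simp
    finally show ?thesis by (simp add: norm_mult mult.assoc)
  qed
  then show ?thesis by blast
qed

lemma schwartz_mult:
  fixes f g :: "'a::euclidean_space \<Rightarrow> complex"
  assumes "schwartz f" and "schwartz g"
  shows "schwartz (\<lambda>x. f x * g x)"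
proof (rule schwartz_coinduct[where P = schwartz_product_sum])
  show "schwartz_product_sum (\<lambda>x. f x * g x)" using assms by (rule product)
  show "h differentiable (at x)" if "schwartz_product_sum h" for h :: "'a \<Rightarrow> complex" and x
    using that by (rule schwartz_product_sum_differentiable)
  show "\<exists>C. \<forall>x. (1 + norm x) ^ k * norm (h x) \<le> C" if "schwartz_product_sum h" for h :: "'a \<Rightarrow> complex" and k
    using that by induction (auto intro: decay_add decay_mult_bounded schwartz_decay schwartz_bounded)
  show "schwartz_product_sum (partial_deriv b h)" if "schwartz_product_sum h" and b: "b \<in> Basis"
    for h :: "'a \<Rightarrow> complex" and b
    using that(1)
  proof induction
    case (product f g)
    then show ?case
      using b by (subst partial_deriv_mult)
        (auto intro!: schwartz_product_sum.intros schwartz_differentiable schwartz_partial_deriv)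
  next
    case (sum f g)
    then show ?case
      by (subst partial_deriv_add) (auto intro!: schwartz_product_sum.sum schwartz_product_sum_differentiable)
  qed
qed

section \<open>Rapidly decaying kernels\<close>

text \<open>Decay is encoded by weighted integrability because this is what dominated convergence
  consumes; it survives multiplication by measurable functions of polynomial growth
  (\<open>rapid_mult\<close>) and passes to tensor products (\<open>rapid_tensor\<close>).\<close>

definition rapid :: "('a::euclidean_space \<Rightarrow> complex) \<Rightarrow> bool" where
  "rapid F \<longleftrightarrow> F \<in> borel_measurable borel \<and>
     (\<forall>k. integrable lborel (\<lambda>y. (1 + norm y) ^ k * norm (F y)))"

lemma rapid_borel_measurable: "rapid F \<Longrightarrow> F \<in> borel_measurable borel"
  by (simp add: rapid_def)

lemma rapidI:
  fixes F :: "'a::euclidean_space \<Rightarrow> complex"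
  assumes [measurable]: "F \<in> borel_measurable borel"
    and "\<And>k. \<exists>C. \<forall>x. (1 + norm x) ^ k * norm (F x) \<le> C"
  shows "rapid F"
  unfolding rapid_def
proof (intro conjI allI)
  fix k
  \<comment> \<open>The surplus of \<open>2 * DIM('a)\<close> powers leaves an integrable weight
    after \<open>k\<close> of them have been spent.\<close>
  obtain C where C: "\<And>x. (1 + norm x) ^ (k + 2 * DIM('a)) * norm (F x) \<le> C"
    using assms(2) by blast
  show "integrable lborel (\<lambda>y. (1 + norm y) ^ k * norm (F y))"
  proof (rule Bochner_Integration.integrable_bound)
    show "integrable lborel (\<lambda>y::'a. C * inverse ((1 + norm y) ^ (2 * DIM('a))))"
      using integrable_inverse_power_norm[where 'a = 'a] by simp
    show "AE y in lborel. norm ((1 + norm y) ^ k * norm (F y)) \<le> norm (C * inverse ((1 + norm y) ^ (2 * DIM('a))))"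
    proof (rule AE_I2)
      fix y :: 'a
      have pos: "0 < (1 + norm y) ^ (2 * DIM('a))" by (simp add: add_pos_nonneg)
      have "(1 + norm y) ^ k * norm (F y) \<le> C / (1 + norm y) ^ (2 * DIM('a))"
        unfolding pos_le_divide_eq[OF pos] using C[of y] by (simp add: power_add mult_ac)
      then have "(1 + norm y) ^ k * norm (F y) \<le> C * inverse ((1 + norm y) ^ (2 * DIM('a)))"
        by (simp add: divide_inverse)
      then have "(1 + norm y) ^ k * norm (F y) \<le> \<bar>C * inverse ((1 + norm y) ^ (2 * DIM('a)))\<bar>"
        by (rule order_trans[OF _ abs_ge_self])
      then show "norm ((1 + norm y) ^ k * norm (F y)) \<le> norm (C * inverse ((1 + norm y) ^ (2 * DIM('a))))"
        by (simp add: abs_mult)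
    qed
  qed measurable
qed (fact assms)

lemma rapid_integrable:
  fixes F p :: "'a::euclidean_space \<Rightarrow> complex"
  assumes F: "rapid F" and [measurable]: "p \<in> borel_measurable borel"
    and p: "\<And>y. norm (p y) \<le> C * (1 + norm y) ^ m"
  shows "integrable lborel (\<lambda>y. p y * F y)"
proof (rule Bochner_Integration.integrable_bound)
  note [measurable] = rapid_borel_measurable[OF F]
  show "integrable lborel (\<lambda>y. C * ((1 + norm y) ^ m * norm (F y)))"
    using F by (auto simp: rapid_def)
  show "AE y in lborel. norm (p y * F y) \<le> norm (C * ((1 + norm y) ^ m * norm (F y)))"
  proof (rule AE_I2)
    fix y
    have "norm (p y * F y) \<le> (C * (1 + norm y) ^ m) * norm (F y)"
      unfolding norm_mult by (intro mult_right_mono p) simp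
    then show "norm (p y * F y) \<le> norm (C * ((1 + norm y) ^ m * norm (F y)))"
      by (simp add: mult.assoc)
  qed
  show "(\<lambda>y. p y * F y) \<in> borel_measurable lborel" by measurable
qed

lemma rapid_integrable_self: "rapid F \<Longrightarrow> integrable lborel F"
  using rapid_integrable[of F "\<lambda>_. 1" 1 0] by simp

lemma rapid_mult:
  fixes F p :: "'a::euclidean_space \<Rightarrow> complex"
  assumes F: "rapid F" and [measurable]: "p \<in> borel_measurable borel"
    and p: "\<And>y. norm (p y) \<le> C * (1 + norm y) ^ m"
  shows "rapid (\<lambda>y. p y * F y)"
  unfolding rapid_def
proof (intro conjI allI)
  note [measurable] = rapid_borel_measurable[OF F]
  show "(\<lambda>y. p y * F y) \<in> borel_measurable borel" by measurable
  fix k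
  have "integrable lborel (\<lambda>y. (of_real ((1 + norm y) ^ k) * p y) * F y)"
  proof (rule rapid_integrable[OF F, of _ C "k + m"])
    fix y :: 'a
    have "(1 + norm y) ^ k * norm (p y) \<le> (1 + norm y) ^ k * (C * (1 + norm y) ^ m)"
      by (intro mult_left_mono p) simp
    then show "norm (of_real ((1 + norm y) ^ k) * p y) \<le> C * (1 + norm y) ^ (k + m)"
      by (simp add: norm_mult power_add mult_ac del: of_real_add of_real_power)
  qed measurable
  then have "integrable lborel (\<lambda>y. norm ((of_real ((1 + norm y) ^ k) * p y) * F y))"
    by (rule integrable_norm)
  then show "integrable lborel (\<lambda>y. (1 + norm y) ^ k * norm (p y * F y))"
    by (simp add: norm_mult mult_ac del: of_real_add of_real_power)
qed

lemma schwartz_rapid: "schwartz f \<Longrightarrow> rapid f"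
  by (intro rapidI schwartz_borel_measurable schwartz_decay)

text \<open>\<open>G\<close> is any bounded function with bounded derivative, so that one statement
  covers both Schwartz functions and the constant 1; the latter gives pure Fourier integrals.
  Differentiating the wave costs one factor of size \<open>norm y\<close>, which the first moment of
  \<open>F\<close> absorbs.\<close>

lemma wave_integral_has_derivative:
  fixes A :: "'a::euclidean_space \<Rightarrow> 'a" and F G :: "'a \<Rightarrow> complex"
  assumes A: "bounded_linear A" and F: "rapid F"
    and G: "\<And>x. (G has_derivative G' x) (at x)"
    and C: "\<And>x. norm (G x) \<le> C" and D: "\<And>x h. norm (G' x h) \<le> D * norm h"
    and [measurable]: "\<And>h. (\<lambda>x. G' x h) \<in> borel_measurable borel"
  shows "((\<lambda>x. \<integral>y. iexp (A x \<bullet> y) * F y * G (x + c *\<^sub>R y) \<partial>lborel) has_derivative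
     (\<lambda>h. \<integral>y. iexp (A x \<bullet> y) * F y * (\<i> * of_real (A h \<bullet> y) * G (x + c *\<^sub>R y) + G' (x + c *\<^sub>R y) h) \<partial>lborel)) (at x)"
proof -
  note [measurable] = rapid_borel_measurable[OF F]
  have "continuous_on UNIV G"
    using G by (intro has_derivative_continuous_on) auto
  then have [measurable]: "G \<in> borel_measurable borel" by (rule borel_measurable_continuous_onI)
  have C0: "0 \<le> C" using order_trans[OF norm_ge_zero C] .
  \<comment> \<open>Testing the bound on \<open>G'\<close> at a unit vector yields
    \<open>0 \<le> D\<close>.\<close>
  obtain b :: 'a where b: "b \<in> Basis" using nonempty_Basis by blast
  have D0: "0 \<le> D" using order_trans[OF norm_ge_zero D[of 0 b]] b by simp
  obtain K where K: "\<And>h. norm (A h) \<le> norm h * K" and K0: "K \<ge> 0"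
    using bounded_linear.nonneg_bounded[OF A] by (auto simp: ac_simps)
  show ?thesis
  proof (rule has_derivative_integral[where B = "\<lambda>y. (K * C + D) * ((1 + norm y) * norm (F y))"])
    show "integrable lborel (\<lambda>y. iexp (A x \<bullet> y) * F y * G (x + c *\<^sub>R y))" for x
      using rapid_integrable[OF F, of "\<lambda>y. iexp (A x \<bullet> y) * G (x + c *\<^sub>R y)" C 0] C
      by (simp add: norm_mult mult_ac)
    show "((\<lambda>x. iexp (A x \<bullet> y) * F y * G (x + c *\<^sub>R y)) has_derivative
        (\<lambda>h. iexp (A x \<bullet> y) * F y * (\<i> * of_real (A h \<bullet> y) * G (x + c *\<^sub>R y) + G' (x + c *\<^sub>R y) h))) (at x)" for x y
    proof -
      have 1: "((\<lambda>x. iexp (A x \<bullet> y)) has_derivative (\<lambda>h. \<i> * of_real (A h \<bullet> y) * iexp (A x \<bullet> y))) (at x)"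
      proof -
        have "bounded_linear (\<lambda>x. \<i> * complex_of_real (A x \<bullet> y))"
          by (intro bounded_linear_compose[OF bounded_linear_mult_right] bounded_linear_compose[OF bounded_linear_of_real]
              bounded_linear_compose[OF bounded_linear_inner_left A])
        then have "((\<lambda>x. \<i> * complex_of_real (A x \<bullet> y)) has_derivative (\<lambda>h. \<i> * complex_of_real (A h \<bullet> y))) (at x)"
          by (rule bounded_linear_imp_has_derivative)
        from has_derivative_compose[OF this DERIV_exp[unfolded has_field_derivative_def]]
        show ?thesis by (simp add: mult.commute)
      qed
      have 2: "((\<lambda>x. G (x + c *\<^sub>R y)) has_derivative G' (x + c *\<^sub>R y)) (at x)"
        using has_derivative_compose[where g = G and f = "\<lambda>x. x + c *\<^sub>R y" and f' = "\<lambda>h. h", OF _ G] 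
        by (simp add: has_derivative_add_const)
      show ?thesis
        by (rule has_derivative_eq_rhs, rule has_derivative_mult[OF has_derivative_mult_left[OF 1] 2])
           (simp add: algebra_simps fun_eq_iff)
    qed
    show "(\<lambda>y. iexp (A x \<bullet> y) * F y * (\<i> * of_real (A h \<bullet> y) * G (x + c *\<^sub>R y) + G' (x + c *\<^sub>R y) h))
        \<in> borel_measurable lborel" for x h
      by measurable
    show "norm (iexp (A x \<bullet> y) * F y * (\<i> * of_real (A h \<bullet> y) * G (x + c *\<^sub>R y) + G' (x + c *\<^sub>R y) h))
        \<le> (K * C + D) * ((1 + norm y) * norm (F y)) * norm h" for x y h
    proof -
      have "\<bar>A h \<bullet> y\<bar> \<le> (norm h * K) * norm y"
        by (rule order_trans[OF Cauchy_Schwarz_ineq2]) (intro mult_right_mono K, simp)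
      then have "norm (\<i> * of_real (A h \<bullet> y) * G (x + c *\<^sub>R y) + G' (x + c *\<^sub>R y) h)
          \<le> ((norm h * K) * norm y) * C + D * norm h"
        by (intro order_trans[OF norm_triangle_ineq] add_mono D)
           (auto simp: norm_mult intro!: mult_mono C mult_nonneg_nonneg K0)
      also have "\<dots> \<le> (K * C + D) * (1 + norm y) * norm h"
        using K0 C0 D0 by (simp add: algebra_simps)
      finally have "norm (F y) * norm (\<i> * of_real (A h \<bullet> y) * G (x + c *\<^sub>R y) + G' (x + c *\<^sub>R y) h)
         \<le> norm (F y) * ((K * C + D) * (1 + norm y) * norm h)"
        by (rule mult_left_mono) simp
      then show ?thesis by (simp add: norm_mult mult_ac)
    qed
    show "integrable lborel (\<lambda>y. (K * C + D) * ((1 + norm y) * norm (F y)))"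
      using F[unfolded rapid_def, THEN conjunct2, THEN spec[of _ 1]] by simp
  qed
qed

section \<open>Fourier integrals\<close>

text \<open>Translation invariance takes the place of integration by parts: translating
  \<open>f\<close> by \<open>s *\<^sub>R b\<close> multiplies its Fourier integral by a phase, and
  differentiating this identity at zero shift gives the claim.\<close>

lemma fourier_partial_deriv:
  fixes f :: "'a::euclidean_space \<Rightarrow> complex"
  assumes f: "schwartz f" and b: "b \<in> Basis"
  shows "(\<integral>y. iexp (u \<bullet> y) * partial_deriv b f y \<partial>lborel)
     = - (\<i> * of_real (u \<bullet> b)) * (\<integral>y. iexp (u \<bullet> y) * f y \<partial>lborel)"
proof -
  let ?f' = "partial_deriv b f"
  \<comment> \<open>The exponent for which \<open>inverse ((1 + norm y) ^ m)\<close> is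
    integrable.\<close>
  define m where "m = 2 * DIM('a)"
  have f': "schwartz ?f'" using f b by (rule schwartz_partial_deriv)
  note [measurable] = schwartz_borel_measurable[OF f] schwartz_borel_measurable[OF f']
  obtain C where C: "\<And>x. (1 + norm x) ^ m * norm (?f' x) \<le> C"
    using schwartz_decay[OF f'] by blast
  have shift: "(\<integral>y. iexp (u \<bullet> y) * f (y + s *\<^sub>R b) \<partial>lborel)
      = iexp (- (s * (u \<bullet> b))) * (\<integral>y. iexp (u \<bullet> y) * f y \<partial>lborel)" for s
  proof -
    have "(\<integral>y. iexp (u \<bullet> y) * f y \<partial>lborel) = (\<integral>y. iexp (u \<bullet> (s *\<^sub>R b + y)) * f (s *\<^sub>R b + y) \<partial>lborel)"
      using integral_lborel_affine[of "\<lambda>y. iexp (u \<bullet> y) * f y" 1 "s *\<^sub>R b"] by simp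
    also have "\<dots> = (\<integral>y. iexp (s * (u \<bullet> b)) * (iexp (u \<bullet> y) * f (y + s *\<^sub>R b)) \<partial>lborel)"
      by (intro Bochner_Integration.integral_cong refl)
         (simp add: inner_add_right distrib_left exp_add add.commute mult_ac)
    also have "\<dots> = iexp (s * (u \<bullet> b)) * (\<integral>y. iexp (u \<bullet> y) * f (y + s *\<^sub>R b) \<partial>lborel)"
      by (rule integral_mult_right_zero)
    finally show ?thesis by (simp add: exp_minus)
  qed
  \<comment> \<open>Differentiate at \<open>t = 0\<close>; the bounded shift \<open>sin t\<close> instead of \<open>t\<close> makes one
    integrable majorant serve for all \<open>t\<close>.\<close>
  have "((\<lambda>t. \<integral>y. iexp (u \<bullet> y) * f (y + sin t *\<^sub>R b) \<partial>lborel) has_derivative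
      (\<lambda>h. \<integral>y. iexp (u \<bullet> y) * ((h * cos 0) *\<^sub>R ?f' (y + sin 0 *\<^sub>R b)) \<partial>lborel)) (at (0::real))"
  proof (rule has_derivative_integral[where B = "\<lambda>y. (2 ^ m * C) * inverse ((1 + norm y) ^ m)"])
    show "integrable lborel (\<lambda>y. iexp (u \<bullet> y) * f (y + sin t *\<^sub>R b))" for t
    proof (rule Bochner_Integration.integrable_bound)
      show "integrable lborel (\<lambda>y. f (sin t *\<^sub>R b + 1 *\<^sub>R y))"
        using rapid_integrable_self[OF schwartz_rapid[OF f]] by (subst integrable_lborel_affine) auto
    qed (auto simp: norm_mult add.commute)
    show "((\<lambda>t. iexp (u \<bullet> y) * f (y + sin t *\<^sub>R b)) has_derivative
        (\<lambda>h. iexp (u \<bullet> y) * ((h * cos t) *\<^sub>R ?f' (y + sin t *\<^sub>R b)))) (at t)" for t y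
    proof -
      have 1: "((\<lambda>t. y + sin t *\<^sub>R b) has_derivative (\<lambda>h. (h * cos t) *\<^sub>R b)) (at t)"
        by (auto intro!: derivative_eq_intros)
      let ?D = "\<lambda>h. \<Sum>c\<in>Basis. (h \<bullet> c) *\<^sub>R partial_deriv c f (y + sin t *\<^sub>R b)"
      have 2: "((\<lambda>t. f (y + sin t *\<^sub>R b)) has_derivative (\<lambda>h. ?D ((h * cos t) *\<^sub>R b))) (at t)"
        using has_derivative_compose[OF 1 has_derivative_partial_derivs[OF schwartz_differentiable[OF f]]] .
      have eq: "?D ((h * cos t) *\<^sub>R b) = (h * cos t) *\<^sub>R ?f' (y + sin t *\<^sub>R b)" for h
        using b by (simp add: inner_Basis if_distrib if_distribR cong: if_cong)
      show ?thesis using has_derivative_mult_right[OF 2[unfolded eq]] .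
    qed
    show "norm (iexp (u \<bullet> y) * ((h * cos t) *\<^sub>R ?f' (y + sin t *\<^sub>R b)))
        \<le> (2 ^ m * C) * inverse ((1 + norm y) ^ m) * norm h" for t y h
    proof -
      let ?z = "y + sin t *\<^sub>R b"
      \<comment> \<open>A shift of length at most 1 changes \<open>1 + norm y\<close> by at most a
        factor 2; this is the origin of the constant \<open>2 ^ m * C\<close>.\<close>
      have "norm (sin t *\<^sub>R b) \<le> 1" using b by simp
      then have le: "norm y \<le> norm ?z + 1"
        using norm_triangle_ineq4[of ?z "sin t *\<^sub>R b"] by simp
      have "1 + n \<le> 2 * (1 + z)" if "n \<le> z + 1" "0 \<le> z" for n z :: real
        using that by simp
      from this[OF le norm_ge_zero] have "1 + norm y \<le> 2 * (1 + norm ?z)" .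
      then have "(1 + norm y) ^ m \<le> (2 * (1 + norm ?z)) ^ m" by (intro power_mono) auto
      from mult_right_mono[OF this norm_ge_zero[of "?f' ?z"]]
      have "(1 + norm y) ^ m * norm (?f' ?z) \<le> 2 ^ m * ((1 + norm ?z) ^ m * norm (?f' ?z))"
        by (simp only: power_mult_distrib mult.assoc)
      also have "\<dots> \<le> 2 ^ m * C" by (intro mult_left_mono C) simp
      finally have 3: "norm (?f' ?z) \<le> (2 ^ m * C) * inverse ((1 + norm y) ^ m)"
        by (simp add: field_simps add_pos_nonneg)
      have "\<bar>h * cos t\<bar> * norm (?f' ?z) \<le> \<bar>h\<bar> * ((2 ^ m * C) * inverse ((1 + norm y) ^ m))"
        by (intro mult_mono 3) (auto simp: abs_mult mult_left_le)
      then show ?thesis by (simp add: norm_mult mult_ac)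
    qed
    show "integrable lborel (\<lambda>y::'a. (2 ^ m * C) * inverse ((1 + norm y) ^ m))"
      using integrable_inverse_power_norm[where 'a = 'a] unfolding m_def by simp
    show "(\<lambda>y. iexp (u \<bullet> y) * ((h * cos t) *\<^sub>R ?f' (y + sin t *\<^sub>R b))) \<in> borel_measurable lborel" for t h
      by measurable
  qed
  \<comment> \<open>The same function of \<open>t\<close>, which by \<open>shift\<close> is an
    explicit phase times a constant, differentiated directly. Uniqueness of the derivative then
    equates the two results.\<close>
  moreover have "((\<lambda>t. \<integral>y. iexp (u \<bullet> y) * f (y + sin t *\<^sub>R b) \<partial>lborel) has_derivative
      (\<lambda>h. of_real h * (- (\<i> * of_real (u \<bullet> b)) * (\<integral>y. iexp (u \<bullet> y) * f y \<partial>lborel)))) (at (0::real))"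
  proof -
    have "((\<lambda>t. - (sin t * (u \<bullet> b))) has_derivative (\<lambda>h. - (h * (u \<bullet> b)))) (at 0)"
      by (auto intro!: derivative_eq_intros)
    then have "((\<lambda>t. \<i> * complex_of_real (- (sin t * (u \<bullet> b)))) has_derivative
        (\<lambda>h. \<i> * complex_of_real (- (h * (u \<bullet> b))))) (at 0)"
      by (intro has_derivative_mult_right has_derivative_of_real)
    from has_derivative_compose[OF this DERIV_exp[unfolded has_field_derivative_def]]
    show ?thesis
      unfolding shift by (rule has_derivative_eq_rhs[OF has_derivative_mult_left]) (simp add: mult_ac)
  qed
  ultimately have "(\<lambda>h. \<integral>y. iexp (u \<bullet> y) * ((h * cos 0) *\<^sub>R ?f' (y + sin 0 *\<^sub>R b)) \<partial>lborel)
     = (\<lambda>h::real. of_real h * (- (\<i> * of_real (u \<bullet> b)) * (\<integral>y. iexp (u \<bullet> y) * f y \<partial>lborel)))"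
    by (rule has_derivative_unique)
  from fun_cong[OF this, of 1] show ?thesis by simp
qed

text \<open>One more power of \<open>1 + norm u\<close> costs one more derivative:
  \<open>1 + norm u\<close> is at most 1 plus the sum of the
  \<open>\<bar>u \<bullet> b\<bar>\<close>, and each of these is traded for
  \<open>partial_deriv b\<close> by \<open>fourier_partial_deriv\<close>. The induction therefore
  has to range over all Schwartz \<open>f\<close>.\<close>

lemma fourier_decay:
  fixes f :: "'a::euclidean_space \<Rightarrow> complex"
  assumes "schwartz f"
  shows "\<exists>C. \<forall>u. (1 + norm u) ^ k * norm (\<integral>y. iexp (u \<bullet> y) * f y \<partial>lborel) \<le> C"
  using assms
proof (induction k arbitrary: f)
  case 0
  have "norm (\<integral>y. iexp (u \<bullet> y) * f y \<partial>lborel) \<le> (\<integral>y. norm (f y) \<partial>lborel)" for u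
    using integral_norm_bound[of lborel "\<lambda>y. iexp (u \<bullet> y) * f y"] by (simp add: norm_mult)
  then show ?case by auto
next
  case (Suc k)
  let ?F = "\<lambda>f u. \<integral>y. iexp (u \<bullet> y) * f y \<partial>lborel"
  have "\<exists>C. \<forall>u. (1 + norm u) ^ k * norm (?F (partial_deriv b f) u) \<le> C" if "b \<in> Basis" for b
    using Suc.IH[OF schwartz_partial_deriv[OF Suc.prems that]] .
  then obtain C where C: "\<And>b u. b \<in> Basis \<Longrightarrow> (1 + norm u) ^ k * norm (?F (partial_deriv b f) u) \<le> C b"
    by metis
  obtain C0 where C0: "\<And>u. (1 + norm u) ^ k * norm (?F f u) \<le> C0" using Suc.IH[OF Suc.prems] by blast
  have "(1 + norm u) ^ Suc k * norm (?F f u) \<le> C0 + (\<Sum>b\<in>Basis. C b)" for u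
  proof -
    have "1 + norm u \<le> 1 + (\<Sum>b\<in>Basis. \<bar>u \<bullet> b\<bar>)" using norm_le_l1[of u] by simp
    then have "(1 + norm u) ^ Suc k * norm (?F f u)
        \<le> (1 + (\<Sum>b\<in>Basis. \<bar>u \<bullet> b\<bar>)) * ((1 + norm u) ^ k * norm (?F f u))"
      by (simp add: mult.assoc mult_right_mono)
    also have "\<dots> = (1 + norm u) ^ k * norm (?F f u)
        + (\<Sum>b\<in>Basis. (1 + norm u) ^ k * norm (?F (partial_deriv b f) u))"
    proof -
      have "norm (?F (partial_deriv b f) u) = \<bar>u \<bullet> b\<bar> * norm (?F f u)" if "b \<in> Basis" for b
        unfolding fourier_partial_deriv[OF Suc.prems that] norm_mult by (simp add: norm_mult)
      then show ?thesis by (simp add: distrib_right distrib_left sum_distrib_right sum_distrib_left mult_ac)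
    qed
    also have "\<dots> \<le> C0 + (\<Sum>b\<in>Basis. C b)"
      by (intro add_mono sum_mono C0 C)
    finally show ?thesis .
  qed
  then show ?case by blast
qed

lemma integrable_tensor:
  fixes f :: "'a::euclidean_space \<Rightarrow> 'c::{real_normed_field, banach, second_countable_topology}"
    and g :: "'b::euclidean_space \<Rightarrow> 'c"
  assumes f: "integrable lborel f" and g: "integrable lborel g"
  shows "integrable (lborel \<Otimes>\<^sub>M lborel) (\<lambda>(x, y). f x * g y)"
proof (rule lborel_pair.Fubini_integrable)
  note [measurable] = borel_measurable_integrable[OF f] borel_measurable_integrable[OF g]
  show "(\<lambda>(x, y). f x * g y) \<in> borel_measurable (lborel \<Otimes>\<^sub>M lborel)" by measurable
qed (use f g in \<open>auto simp: norm_mult\<close>)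

lemma tendsto_inverse_Suc_scaleR: "(\<lambda>n. x + inverse (real (Suc n)) *\<^sub>R v) \<longlonglongrightarrow> (x::'a::real_normed_vector)"
  using tendsto_add[OF tendsto_const[of x] tendsto_scaleR[OF LIMSEQ_inverse_real_of_nat tendsto_const[of v]]] by simp

text \<open>Gaussian summation. The isometry \<open>A\<close> keeps the Gaussian transform radial,
  and its skewness makes a second application of the same transform undo the first, where the
  Euclidean pairing would produce a reflection.\<close>

lemma fourier_inversion:
  fixes f :: "'a::euclidean_space \<Rightarrow> complex" and A :: "'a \<Rightarrow> 'a"
  assumes f: "integrable lborel f" and cont: "continuous_on UNIV f" and bound: "\<And>x. norm (f x) \<le> C"
    and A: "linear A" and isometry: "\<And>x. norm (A x) = norm x" and skew: "\<And>x y. A x \<bullet> y = - (A y \<bullet> x)"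
    and int: "integrable lborel (\<lambda>z. \<integral>y. iexp (A z \<bullet> y) * f y \<partial>lborel)"
  shows "(\<integral>z. iexp (A x \<bullet> z) * (\<integral>y. iexp (A z \<bullet> y) * f y \<partial>lborel) \<partial>lborel) = (2 * pi) ^ DIM('a) * f x"
proof -
  have [measurable]: "f \<in> borel_measurable borel" using cont by (rule borel_measurable_continuous_onI)
  note [measurable] = borel_measurable_continuous_onI[OF linear_continuous_on[OF A[unfolded linear_conv_bounded_linear]]]
  let ?F = "\<lambda>z. \<integral>y. iexp (A z \<bullet> y) * f y \<partial>lborel"
  let ?g = "\<lambda>v::'a. complex_of_real (exp (- (norm v)\<^sup>2 / 2))"
  have [measurable]: "?F \<in> borel_measurable borel" using borel_measurable_integrable[OF int] by simp
  have g: "integrable lborel ?g" using integrable_gaussian_wave[of "0::'a"] by simp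
  define d where "d n = inverse (real (Suc n))" for n
  have d: "d n > 0" for n by (simp add: d_def)
  have gd: "integrable lborel (\<lambda>z. ?g (d n *\<^sub>R z))" for n
    using integrable_lborel_affine[of ?g "d n" 0] g d[of n] by simp
  \<comment> \<open>The undamped integrand has modulus \<open>norm (f y)\<close>, constant in
    \<open>z\<close>, so Fubini does not apply to it. The Gaussian of width
    \<open>inverse (d n)\<close> makes it jointly integrable, and exchanging the integrals turns the
    left side into an average of \<open>f\<close> around \<open>x\<close>.\<close>
  have smoothed: "(\<integral>z. iexp (A x \<bullet> z) * ?F z * ?g (d n *\<^sub>R z) \<partial>lborel)
      = sqrt (2 * pi) ^ DIM('a) * (\<integral>v. f (x + d n *\<^sub>R v) * ?g v \<partial>lborel)" for n
  proof -
    have "(\<integral>z. iexp (A x \<bullet> z) * ?F z * ?g (d n *\<^sub>R z) \<partial>lborel)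
        = (\<integral>z. (\<integral>y. iexp (A x \<bullet> z) * (iexp (A z \<bullet> y) * f y) * ?g (d n *\<^sub>R z) \<partial>lborel) \<partial>lborel)"
      by (simp only: integral_mult_right_zero integral_mult_left_zero)
    also have "\<dots> = (\<integral>y. (\<integral>z. iexp (A x \<bullet> z) * (iexp (A z \<bullet> y) * f y) * ?g (d n *\<^sub>R z) \<partial>lborel) \<partial>lborel)"
    proof (rule lborel_pair.Fubini_integral[symmetric])
      show "integrable (lborel \<Otimes>\<^sub>M lborel) (\<lambda>(z, y). iexp (A x \<bullet> z) * (iexp (A z \<bullet> y) * f y) * ?g (d n *\<^sub>R z))"
      proof (rule Bochner_Integration.integrable_bound[OF integrable_tensor[OF gd[of n] f]])
        show "(\<lambda>(z, y). iexp (A x \<bullet> z) * (iexp (A z \<bullet> y) * f y) * ?g (d n *\<^sub>R z))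
           \<in> borel_measurable (lborel \<Otimes>\<^sub>M lborel)" by measurable
      qed (auto simp: norm_mult)
    qed
    also have "\<dots> = (\<integral>y. f y * (\<integral>z. iexp (A (x - y) \<bullet> z) * ?g (d n *\<^sub>R z) \<partial>lborel) \<partial>lborel)"
    proof (rule Bochner_Integration.integral_cong[OF refl])
      fix y
      have "iexp (A x \<bullet> z) * (iexp (A z \<bullet> y) * f y) * ?g (d n *\<^sub>R z) = f y * (iexp (A (x - y) \<bullet> z) * ?g (d n *\<^sub>R z))" for z
      proof -
        \<comment> \<open>Skewness merges the two phases into a single wave in \<open>z\<close> that
          depends on \<open>x - y\<close> only, hence the convolution.\<close>
        have "A x \<bullet> z + A z \<bullet> y = A (x - y) \<bullet> z"
          unfolding linear_diff[OF A] inner_diff_left skew[of z y] by simp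
        then have e: "iexp (A x \<bullet> z) * iexp (A z \<bullet> y) = iexp (A (x - y) \<bullet> z)"
          by (simp only: exp_add[symmetric] distrib_left[symmetric] of_real_add[symmetric])
        show ?thesis unfolding e[symmetric] by (simp only: mult_ac)
      qed
      then show "(\<integral>z. iexp (A x \<bullet> z) * (iexp (A z \<bullet> y) * f y) * ?g (d n *\<^sub>R z) \<partial>lborel)
          = f y * (\<integral>z. iexp (A (x - y) \<bullet> z) * ?g (d n *\<^sub>R z) \<partial>lborel)"
        by (simp only: integral_mult_right_zero)
    qed
    also have "(\<lambda>y. \<integral>z. iexp (A (x - y) \<bullet> z) * ?g (d n *\<^sub>R z) \<partial>lborel)
        = (\<lambda>y. inverse (d n) ^ DIM('a) * (sqrt (2 * pi) ^ DIM('a) * ?g (inverse (d n) *\<^sub>R (x - y))))"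
    proof
      fix y
      have "(\<integral>z. iexp (A (x - y) \<bullet> z) * ?g (d n *\<^sub>R z) \<partial>lborel)
         = inverse (d n) ^ DIM('a) *\<^sub>R (\<integral>z. iexp ((inverse (d n) *\<^sub>R A (x - y)) \<bullet> z) * ?g z \<partial>lborel)"
        using d[of n]
        by (subst integral_lborel_affine[where c = "inverse (d n)" and t = 0]) simp_all
      also have "\<dots> = inverse (d n) ^ DIM('a) * (sqrt (2 * pi) ^ DIM('a) * ?g (inverse (d n) *\<^sub>R (x - y)))"
        unfolding integral_gaussian_wave by (simp add: isometry scaleR_conv_of_real)
      finally show "(\<integral>z. iexp (A (x - y) \<bullet> z) * ?g (d n *\<^sub>R z) \<partial>lborel)
         = inverse (d n) ^ DIM('a) * (sqrt (2 * pi) ^ DIM('a) * ?g (inverse (d n) *\<^sub>R (x - y)))" .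
    qed
    \<comment> \<open>Substitution \<open>y = x + d n *\<^sub>R v\<close>: its Jacobian cancels the
      power of \<open>inverse (d n)\<close> left by rescaling the Gaussian.\<close>
    also have "(\<integral>y. f y * (inverse (d n) ^ DIM('a) * (sqrt (2 * pi) ^ DIM('a) * ?g (inverse (d n) *\<^sub>R (x - y)))) \<partial>lborel)
       = d n ^ DIM('a) *\<^sub>R (\<integral>v. f (x + d n *\<^sub>R v) * (inverse (d n) ^ DIM('a) * (sqrt (2 * pi) ^ DIM('a) * ?g v)) \<partial>lborel)"
      using d[of n] by (subst integral_lborel_affine[where c = "d n" and t = x]) simp_all
    also have "\<dots> = d n ^ DIM('a) *\<^sub>R (\<integral>v. (inverse (d n) ^ DIM('a) * sqrt (2 * pi) ^ DIM('a)) * (f (x + d n *\<^sub>R v) * ?g v) \<partial>lborel)"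
      by (simp add: mult_ac)
    also have "\<dots> = d n ^ DIM('a) *\<^sub>R ((inverse (d n) ^ DIM('a) * sqrt (2 * pi) ^ DIM('a)) * (\<integral>v. f (x + d n *\<^sub>R v) * ?g v \<partial>lborel))"
      by (subst integral_mult_right_zero) simp
    also have "\<dots> = sqrt (2 * pi) ^ DIM('a) * (\<integral>v. f (x + d n *\<^sub>R v) * ?g v \<partial>lborel)"
      using d[of n] by (simp add: scaleR_conv_of_real power_inverse)
    finally show ?thesis .
  qed
  \<comment> \<open>Removing the damping: it is bounded by 1, so the transform, integrable by
    assumption, is the majorant.\<close>
  have "(\<lambda>n. \<integral>z. iexp (A x \<bullet> z) * ?F z * ?g (d n *\<^sub>R z) \<partial>lborel) \<longlonglongrightarrow> (\<integral>z. iexp (A x \<bullet> z) * ?F z \<partial>lborel)"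
  proof (rule integral_dominated_convergence[where w = "\<lambda>z. norm (?F z)"])
    show "AE z in lborel. (\<lambda>n. iexp (A x \<bullet> z) * ?F z * ?g (d n *\<^sub>R z)) \<longlonglongrightarrow> iexp (A x \<bullet> z) * ?F z"
    proof (rule AE_I2)
      fix z :: 'a
      have "(\<lambda>n. d n *\<^sub>R z) \<longlonglongrightarrow> 0"
        using tendsto_inverse_Suc_scaleR[of 0 z] by (simp add: d_def)
      then have "(\<lambda>n. ?g (d n *\<^sub>R z)) \<longlonglongrightarrow> ?g 0"
        by (intro tendsto_intros) auto
      then show "(\<lambda>n. iexp (A x \<bullet> z) * ?F z * ?g (d n *\<^sub>R z)) \<longlonglongrightarrow> iexp (A x \<bullet> z) * ?F z"
        using tendsto_mult_left[of _ 1] by fastforce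
    qed
  qed (use int in \<open>auto simp: norm_mult mult_left_le\<close>)
  \<comment> \<open>The averages concentrate at \<open>x\<close> by continuity; boundedness of
    \<open>f\<close> makes a multiple of the Gaussian the majorant.\<close>
  moreover have "(\<lambda>n. \<integral>v. f (x + d n *\<^sub>R v) * ?g v \<partial>lborel) \<longlonglongrightarrow> (\<integral>v. f x * ?g v \<partial>lborel)"
  proof (rule integral_dominated_convergence[where w = "\<lambda>v. C * norm (?g v)"])
    show "AE v in lborel. (\<lambda>n. f (x + d n *\<^sub>R v) * ?g v) \<longlonglongrightarrow> f x * ?g v"
    proof (rule AE_I2)
      fix v :: 'a
      have "isCont f x" using cont by (simp add: continuous_on_eq_continuous_at)
      then have "(\<lambda>n. f (x + d n *\<^sub>R v)) \<longlonglongrightarrow> f x"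
        using tendsto_inverse_Suc_scaleR[of x v] unfolding d_def by (rule isCont_tendsto_compose)
      then show "(\<lambda>n. f (x + d n *\<^sub>R v) * ?g v) \<longlonglongrightarrow> f x * ?g v" by (rule tendsto_mult_right)
    qed
    show "AE v in lborel. norm (f (x + d n *\<^sub>R v) * ?g v) \<le> C * norm (?g v)" for n
      unfolding norm_mult by (intro AE_I2 mult_right_mono bound) simp
    show "integrable lborel (\<lambda>v. C * norm (?g v))" using g by (intro integrable_mult_right integrable_norm)
  qed measurable
  ultimately have "(\<integral>z. iexp (A x \<bullet> z) * ?F z \<partial>lborel) = sqrt (2 * pi) ^ DIM('a) * (\<integral>v. f x * ?g v \<partial>lborel)"
    using LIMSEQ_unique tendsto_mult_left unfolding smoothed by blast
  also have "(\<integral>v. f x * ?g v \<partial>lborel) = f x * (\<integral>v. ?g v \<partial>lborel)"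
    by (rule integral_mult_right_zero)
  also have "(\<integral>v. ?g v \<partial>lborel) = of_real (sqrt (2 * pi) ^ DIM('a))"
    using integral_gaussian_wave[of "0::'a"] by simp
  also have "sqrt (2 * pi) ^ DIM('a) * (f x * of_real (sqrt (2 * pi) ^ DIM('a)))
      = of_real ((sqrt (2 * pi) * sqrt (2 * pi)) ^ DIM('a)) * f x"
    unfolding power_mult_distrib of_real_mult of_real_power by (simp only: mult_ac)
  also have "sqrt (2 * pi) * sqrt (2 * pi) = 2 * pi" by simp
  finally show ?thesis by simp
qed

section \<open>Wave integrals as Schwartz functions\<close>

text \<open>A derivative of a wave integral is a sum of two: falling on the wave it multiplies
  \<open>F\<close> by a linear factor, which keeps it \<open>rapid\<close>; falling on
  \<open>G\<close> it keeps it Schwartz. The Weyl product is, up to a constant, the case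
  \<open>F = sympl_fourier f\<close>, \<open>G = g\<close>, \<open>A = sympl_map\<close>,
  \<open>c = \<epsilon> / 2\<close>.\<close>

inductive wave_sum :: "('a::euclidean_space \<Rightarrow> 'a) \<Rightarrow> real \<Rightarrow> ('a \<Rightarrow> complex) \<Rightarrow> bool" for A c where
  wave: "rapid F \<Longrightarrow> schwartz G \<Longrightarrow> wave_sum A c (\<lambda>x. \<integral>y. iexp (A x \<bullet> y) * F y * G (x + c *\<^sub>R y) \<partial>lborel)"
| sum: "wave_sum A c f \<Longrightarrow> wave_sum A c g \<Longrightarrow> wave_sum A c (\<lambda>x. f x + g x)"

lemma schwartz_wave_integral_has_derivative:
  fixes A :: "'a::euclidean_space \<Rightarrow> 'a" and F G :: "'a \<Rightarrow> complex"
  assumes A: "bounded_linear A" and F: "rapid F" and G: "schwartz G"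
  defines "G' \<equiv> \<lambda>x h. \<Sum>b\<in>Basis. (h \<bullet> b) *\<^sub>R partial_deriv b G x"
  shows "((\<lambda>x. \<integral>y. iexp (A x \<bullet> y) * F y * G (x + c *\<^sub>R y) \<partial>lborel) has_derivative
     (\<lambda>h. \<integral>y. iexp (A x \<bullet> y) * F y * (\<i> * of_real (A h \<bullet> y) * G (x + c *\<^sub>R y) + G' (x + c *\<^sub>R y) h) \<partial>lborel)) (at x)"
proof -
  have "\<exists>D. \<forall>x. norm (partial_deriv b G x) \<le> D" if "b \<in> Basis" for b
    using schwartz_bounded[OF schwartz_partial_deriv[OF G that]] by blast
  then obtain D where D: "\<And>b x. b \<in> Basis \<Longrightarrow> norm (partial_deriv b G x) \<le> D b" by metis
  obtain C where C: "\<And>x. norm (G x) \<le> C" using schwartz_bounded[OF G] by blast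
  show ?thesis
  proof (rule wave_integral_has_derivative[OF A F _ C])
    show "(G has_derivative G' x) (at x)" for x
      unfolding G'_def by (intro has_derivative_partial_derivs schwartz_differentiable G)
    show "norm (G' x h) \<le> (\<Sum>b\<in>Basis. D b) * norm h" for x h
    proof -
      have "norm (G' x h) \<le> (\<Sum>b\<in>Basis. norm h * D b)"
        unfolding G'_def by (intro sum_norm_le) (auto intro!: mult_mono D Basis_le_norm)
      then show ?thesis by (simp add: sum_distrib_left mult.commute)
    qed
    show "(\<lambda>x. G' x h) \<in> borel_measurable borel" for h
    proof -
      have "(\<lambda>x. partial_deriv b G x) \<in> borel_measurable borel" if "b \<in> Basis" for b
        by (intro schwartz_borel_measurable schwartz_partial_deriv G that)
      then show ?thesis unfolding G'_def by (auto intro!: borel_measurable_sum borel_measurable_scaleR)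
    qed
  qed
qed

lemma rapid_inner:
  fixes F :: "'a::euclidean_space \<Rightarrow> complex"
  assumes "rapid F"
  shows "rapid (\<lambda>y. \<i> * of_real (a \<bullet> y) * F y)"
proof (rule rapid_mult[OF assms])
  show "norm (\<i> * of_real (a \<bullet> y)) \<le> norm a * (1 + norm y) ^ 1" for y
    using order_trans[OF Cauchy_Schwarz_ineq2[of a y] mult_left_mono[of "norm y" "1 + norm y" "norm a"]]
    by (simp add: norm_mult)
qed measurable

lemma wave_sum_differentiable:
  assumes A: "bounded_linear A" and "wave_sum A c f"
  shows "f differentiable (at x)"
  using assms(2)
proof induction
  case (wave F G)
  show ?case by (rule differentiableI) (rule schwartz_wave_integral_has_derivative[OF A wave])
next
  case (sum f g)
  then show ?case by (intro differentiable_add)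
qed

lemma wave_sum_partial_deriv:
  assumes A: "bounded_linear A" and b: "b \<in> Basis" and "wave_sum A c h"
  shows "wave_sum A c (partial_deriv b h)"
  using assms(3)
proof induction
  case (wave F G)
  note [measurable] = rapid_borel_measurable[OF wave(1)]
  have G': "schwartz (partial_deriv b G)" using wave(2) b by (rule schwartz_partial_deriv)
  let ?F' = "\<lambda>y. \<i> * of_real (A b \<bullet> y) * F y"
  let ?W = "\<lambda>F G x. \<integral>y. iexp (A x \<bullet> y) * F y * G (x + c *\<^sub>R y) \<partial>lborel"
  have int: "integrable lborel (\<lambda>y. iexp (A x \<bullet> y) * F y * G (x + c *\<^sub>R y))"
    if F: "rapid F" and G: "schwartz G" for x F G
  proof -
    note [measurable] = rapid_borel_measurable[OF F] schwartz_borel_measurable[OF G]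
    obtain C where "\<And>x. norm (G x) \<le> C" using schwartz_bounded[OF G] by blast
    then have "integrable lborel (\<lambda>y. (iexp (A x \<bullet> y) * G (x + c *\<^sub>R y)) * F y)"
      by (intro rapid_integrable[OF F, where C = C and m = 0]) (auto simp: norm_mult)
    then show ?thesis by (simp add: mult_ac)
  qed
  have "partial_deriv b (?W F G) x = ?W ?F' G x + ?W F (partial_deriv b G) x" for x
  proof -
    have "(\<Sum>a\<in>Basis. (b \<bullet> a) *\<^sub>R partial_deriv a G z) = partial_deriv b G z" for z
      using b by (simp add: inner_Basis if_distrib if_distribR cong: if_cong)
    then have "partial_deriv b (?W F G) x
      = (\<integral>y. iexp (A x \<bullet> y) * F y * (\<i> * of_real (A b \<bullet> y) * G (x + c *\<^sub>R y) + partial_deriv b G (x + c *\<^sub>R y)) \<partial>lborel)"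
      using partial_deriv_eq[OF schwartz_wave_integral_has_derivative[OF A wave, of c x], of b] by simp
    also have "\<dots> = (\<integral>y. iexp (A x \<bullet> y) * ?F' y * G (x + c *\<^sub>R y)
        + iexp (A x \<bullet> y) * F y * partial_deriv b G (x + c *\<^sub>R y) \<partial>lborel)"
      by (simp add: algebra_simps)
    also have "\<dots> = ?W ?F' G x + ?W F (partial_deriv b G) x"
      by (intro Bochner_Integration.integral_add int rapid_inner wave G')
    finally show ?thesis .
  qed
  then have "partial_deriv b (?W F G) = (\<lambda>x. ?W ?F' G x + ?W F (partial_deriv b G) x)" by blast
  then show ?case
    using wave_sum.sum[OF wave_sum.wave[OF rapid_inner[OF wave(1)] wave(2)] wave_sum.wave[OF wave(1) G']] by simp
next
  case (sum f g)
  then show ?case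
    by (subst partial_deriv_add) (auto intro: wave_sum_differentiable[OF A] wave_sum.sum)
qed

text \<open>The decay in \<open>x\<close> comes from \<open>G\<close>: for
  \<open>\<bar>c\<bar> \<le> 1\<close>, \<open>1 + norm x\<close> is at most
  \<open>(1 + norm (x + c *\<^sub>R y)) * (1 + norm y)\<close>. The first factor is absorbed by
  \<open>G\<close>, the second by the moments of \<open>F\<close>.\<close>

lemma wave_integral_decay:
  fixes A :: "'a::euclidean_space \<Rightarrow> 'a" and F G :: "'a \<Rightarrow> complex"
  assumes F: "rapid F" and G: "schwartz G" and c: "\<bar>c\<bar> \<le> 1"
  shows "\<exists>C. \<forall>x. (1 + norm x) ^ k * norm (\<integral>y. iexp (A x \<bullet> y) * F y * G (x + c *\<^sub>R y) \<partial>lborel) \<le> C"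
proof -
  note [measurable] = rapid_borel_measurable[OF F] schwartz_borel_measurable[OF G]
  obtain C where C: "\<And>x. (1 + norm x) ^ k * norm (G x) \<le> C" using schwartz_decay[OF G] by blast
  have int: "integrable lborel (\<lambda>y. C * ((1 + norm y) ^ k * norm (F y)))"
    using F by (auto simp: rapid_def)
  have "(1 + norm x) ^ k * norm (\<integral>y. iexp (A x \<bullet> y) * F y * G (x + c *\<^sub>R y) \<partial>lborel)
     \<le> (\<integral>y. C * ((1 + norm y) ^ k * norm (F y)) \<partial>lborel)" for x
  proof -
    have le: "norm (of_real ((1 + norm x) ^ k) * (iexp (A x \<bullet> y) * F y * G (x + c *\<^sub>R y)))
        \<le> C * ((1 + norm y) ^ k * norm (F y))" for y
    proof -
      let ?z = "x + c *\<^sub>R y"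
      have "norm x \<le> norm ?z + \<bar>c\<bar> * norm y"
        using norm_triangle_ineq4[of ?z "c *\<^sub>R y"] by simp
      moreover have "\<bar>c\<bar> * norm y \<le> norm y" using c by (simp add: mult_left_le_one_le)
      moreover have "0 \<le> norm ?z * norm y" by simp
      ultimately have "1 + norm x \<le> (1 + norm ?z) * (1 + norm y)"
        unfolding distrib_left distrib_right by linarith
      then have "(1 + norm x) ^ k \<le> ((1 + norm ?z) * (1 + norm y)) ^ k"
        by (intro power_mono) auto
      then have "(1 + norm x) ^ k * (norm (F y) * norm (G ?z))
          \<le> ((1 + norm ?z) * (1 + norm y)) ^ k * (norm (F y) * norm (G ?z))"
        by (rule mult_right_mono) simp
      also have "\<dots> = ((1 + norm ?z) ^ k * norm (G ?z)) * ((1 + norm y) ^ k * norm (F y))"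
        by (simp add: power_mult_distrib mult_ac)
      also have "\<dots> \<le> C * ((1 + norm y) ^ k * norm (F y))"
        by (intro mult_right_mono C) simp
      finally show ?thesis by (simp add: norm_mult del: of_real_power of_real_add)
    qed
    have "(1 + norm x) ^ k * norm (\<integral>y. iexp (A x \<bullet> y) * F y * G (x + c *\<^sub>R y) \<partial>lborel)
      = norm (\<integral>y. of_real ((1 + norm x) ^ k) * (iexp (A x \<bullet> y) * F y * G (x + c *\<^sub>R y)) \<partial>lborel)"
      unfolding integral_mult_right_zero norm_mult norm_of_real by simp
    also have "\<dots> \<le> (\<integral>y. C * ((1 + norm y) ^ k * norm (F y)) \<partial>lborel)"
      using le by (intro Bochner_Integration.integral_norm_bound_integral int
          Bochner_Integration.integrable_bound[OF int] AE_I2)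
        (auto intro: order_trans[OF le abs_ge_self] simp del: of_real_power of_real_add)
    finally show ?thesis .
  qed
  then show ?thesis by blast
qed

lemma schwartz_wave_integral:
  fixes A :: "'a::euclidean_space \<Rightarrow> 'a" and F G :: "'a \<Rightarrow> complex"
  assumes A: "bounded_linear A" and F: "rapid F" and G: "schwartz G" and c: "\<bar>c\<bar> \<le> 1"
  shows "schwartz (\<lambda>x. \<integral>y. iexp (A x \<bullet> y) * F y * G (x + c *\<^sub>R y) \<partial>lborel)"
proof (rule schwartz_coinduct[where P = "wave_sum A c"])
  show "wave_sum A c (\<lambda>x. \<integral>y. iexp (A x \<bullet> y) * F y * G (x + c *\<^sub>R y) \<partial>lborel)"
    using F G by (rule wave)
  show "\<exists>C. \<forall>x. (1 + norm x) ^ k * norm (h x) \<le> C" if "wave_sum A c h" for h k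
    using that by induction (auto intro: wave_integral_decay c decay_add)
qed (auto intro: wave_sum_differentiable wave_sum_partial_deriv A)

section \<open>The Weyl product on phase space\<close>

text \<open>The standard complex structure of phase space. It writes \<sigma> as a Euclidean inner
  product with a skew isometry in one slot, the form in which the Fourier lemmas apply.\<close>

definition sympl_map :: "'d::finite phase_space \<Rightarrow> 'd phase_space" where
  "sympl_map X = (snd X, - fst X)"

lemma sympl_eq_inner: "sympl X Y = sympl_map X \<bullet> Y"
  by (simp add: sympl_def sympl_map_def inner_prod_def)

lemma linear_sympl_map: "linear sympl_map"
  by (rule linearI) (simp_all add: sympl_map_def)

lemma norm_sympl_map: "norm (sympl_map X) = norm X"
  by (simp add: sympl_map_def norm_prod_def add.commute)

lemma sympl_skew: "sympl X Y = - sympl Y X"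
  by (simp add: sympl_def inner_commute)

lemma sympl_add_left: "sympl (X + Y) Z = sympl X Z + sympl Y Z"
  and sympl_add_right: "sympl X (Y + Z) = sympl X Y + sympl X Z"
  and sympl_scaleR_left: "sympl (r *\<^sub>R X) Y = r * sympl X Y"
  by (simp_all add: sympl_def algebra_simps)

lemma abs_sympl_le: "\<bar>sympl X Y\<bar> \<le> norm X * norm Y"
  using Cauchy_Schwarz_ineq2[of "sympl_map X" Y] by (simp add: sympl_eq_inner norm_sympl_map)

lemma borel_measurable_sympl [measurable (raw)]:
  assumes "f \<in> M \<rightarrow>\<^sub>M borel" "g \<in> M \<rightarrow>\<^sub>M borel"
  shows "(\<lambda>x. sympl (f x) (g x)) \<in> borel_measurable M"
  by (rule borel_measurable_continuous_Pair[OF assms])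
     (auto simp: sympl_def intro!: continuous_intros)

lemma DIM_phase_space: "DIM('d::finite phase_space) = 2 * CARD('d)"
  by simp

lemma rapid_sympl_fourier:
  fixes f :: "'d::finite phase_space \<Rightarrow> complex"
  assumes f: "schwartz f"
  shows "rapid (sympl_fourier f)"
proof (rule rapidI)
  note [measurable] = schwartz_borel_measurable[OF f]
  show "sympl_fourier f \<in> borel_measurable borel"
    unfolding sympl_fourier_def by measurable
  fix k
  obtain C where C: "\<And>u. (1 + norm u) ^ k * norm (\<integral>y. iexp (u \<bullet> y) * f y \<partial>lborel) \<le> C"
    using fourier_decay[OF f] by blast
  let ?c = "norm (1 / (2 * of_real pi) ^ CARD('d) :: complex)"
  have "(1 + norm X) ^ k * norm (sympl_fourier f X) \<le> ?c * C" for X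
    using mult_left_mono[OF C[of "sympl_map X"], of ?c]
    unfolding sympl_fourier_def norm_mult sympl_eq_inner norm_sympl_map by (simp add: mult_ac)
  then show "\<exists>C. \<forall>X. (1 + norm X) ^ k * norm (sympl_fourier f X) \<le> C" by blast
qed

text \<open>Phase space has dimension twice \<open>CARD('d)\<close>, so the constant of
  \<open>fourier_inversion\<close> is the square of the one normalising
  \<open>sympl_fourier\<close>; one factor is used up by that normalisation and the other
  remains.\<close>

lemma sympl_fourier_inversion:
  fixes f :: "'d::finite phase_space \<Rightarrow> complex"
  assumes f: "schwartz f"
  shows "(\<integral>Z. iexp (sympl X Z) * sympl_fourier f Z \<partial>lborel) = (2 * of_real pi) ^ CARD('d) * f X"
proof -
  let ?c = "(2 * of_real pi) ^ CARD('d) :: complex"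
  have c: "?c \<noteq> 0" by simp
  have F: "(\<integral>y. iexp (sympl_map z \<bullet> y) * f y \<partial>lborel) = ?c * sympl_fourier f z" for z
    using c by (simp add: sympl_fourier_def sympl_eq_inner)
  obtain C where C: "\<And>x. norm (f x) \<le> C" using schwartz_bounded[OF f] by blast
  have "(\<integral>z. iexp (sympl_map X \<bullet> z) * (\<integral>y. iexp (sympl_map z \<bullet> y) * f y \<partial>lborel) \<partial>lborel)
      = (2 * pi) ^ DIM('d phase_space) * f X"
  proof (rule fourier_inversion[OF rapid_integrable_self[OF schwartz_rapid[OF f]] schwartz_continuous[OF f] C
        linear_sympl_map norm_sympl_map])
    show "sympl_map x \<bullet> y = - (sympl_map y \<bullet> x)" for x y :: "'d phase_space"
      using sympl_skew[of x y] by (simp add: sympl_eq_inner)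
    show "integrable lborel (\<lambda>z. \<integral>y. iexp (sympl_map z \<bullet> y) * f y \<partial>lborel)"
      unfolding F by (intro integrable_mult_right rapid_integrable_self rapid_sympl_fourier f)
  qed
  moreover have "iexp (sympl_map X \<bullet> z) * (?c * sympl_fourier f z)
      = ?c * (iexp (sympl X z) * sympl_fourier f z)" for z
    unfolding sympl_eq_inner by (rule mult.left_commute)
  moreover have "complex_of_real (2 * pi) ^ DIM('d phase_space) = ?c * ?c"
    by (simp add: DIM_phase_space mult_2[of "CARD('d)"] power_add)
  ultimately have "?c * (\<integral>z. iexp (sympl X z) * sympl_fourier f z \<partial>lborel) = ?c * (?c * f X)"
    by (simp only: F integral_mult_right_zero of_real_power mult.assoc)
  then show ?thesis using c by simp
qed

text \<open>The twist is linear in \<open>Z\<close> and joins the other phase: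
  \<open>sympl X Z + \<epsilon> / 2 * sympl Y Z\<close> is
  \<open>sympl (X + (\<epsilon> / 2) *\<^sub>R Y) Z\<close>. The inner integral is thus the
  inversion formula for \<open>g\<close> at a shifted point.\<close>

lemma weyl_prod_eq_wave_integral:
  fixes f g :: "'d::finite phase_space \<Rightarrow> complex"
  assumes g: "schwartz g"
  shows "weyl_prod \<epsilon> f g X = 1 / (2 * of_real pi) ^ CARD('d) *
    (\<integral>Y. iexp (sympl_map X \<bullet> Y) * sympl_fourier f Y * g (X + (\<epsilon> / 2) *\<^sub>R Y) \<partial>lborel)"
proof -
  let ?c = "(2 * of_real pi) ^ CARD('d) :: complex"
  have inner: "(\<integral>Z. iexp (sympl X (Y + Z)) * iexp (\<epsilon> / 2 * sympl Y Z) * sympl_fourier f Y * sympl_fourier g Z \<partial>lborel)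
      = ?c * (iexp (sympl_map X \<bullet> Y) * sympl_fourier f Y * g (X + (\<epsilon> / 2) *\<^sub>R Y))" for Y
  proof -
    have "iexp (sympl X (Y + Z)) * iexp (\<epsilon> / 2 * sympl Y Z) * sympl_fourier f Y * sympl_fourier g Z
      = (iexp (sympl_map X \<bullet> Y) * sympl_fourier f Y) *
        (iexp (sympl (X + (\<epsilon> / 2) *\<^sub>R Y) Z) * sympl_fourier g Z)" for Z
    proof -
      have "iexp (sympl (X + (\<epsilon> / 2) *\<^sub>R Y) Z) = iexp (sympl X Z) * iexp (\<epsilon> / 2 * sympl Y Z)"
        by (simp add: sympl_add_left sympl_scaleR_left exp_add distrib_left)
      moreover have "iexp (sympl X (Y + Z)) = iexp (sympl X Y) * iexp (sympl X Z)"
        by (simp add: sympl_add_right exp_add distrib_left)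
      ultimately show ?thesis by (simp only: sympl_eq_inner[symmetric] mult_ac)
    qed
    then show ?thesis
      by (simp only: sympl_fourier_inversion[OF g] integral_mult_right_zero mult.left_commute[of _ ?c])
  qed
  have "?c \<noteq> 0" by simp
  then show ?thesis
    unfolding weyl_prod_def inner integral_mult_right_zero
    by (simp add: mult_2[of "CARD('d)"] power_add)
qed

lemma schwartz_weyl_prod:
  assumes "schwartz f" and "schwartz g" and "\<bar>\<epsilon>\<bar> \<le> 2"
  shows "schwartz (weyl_prod \<epsilon> f g)"
  unfolding weyl_prod_eq_wave_integral[OF assms(2), abs_def]
  by (intro schwartz_cmult schwartz_wave_integral rapid_sympl_fourier assms)
     (use assms in \<open>auto simp: linear_sympl_map linear_conv_bounded_linear[symmetric]\<close>)

section \<open>Tensor products and the bidifferential operator\<close>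

text \<open>A class stable under \<open>moyal_op\<close>, since each derivative acts in one slot
  only. Restriction to the diagonal turns tensors into products of Schwartz functions, so the decay
  of \<open>weyl_term\<close> comes directly from derivatives of \<open>f\<close> and
  \<open>g\<close>.\<close>

inductive tensor_sum :: "('a::euclidean_space \<times> 'a \<Rightarrow> complex) \<Rightarrow> bool" where
  tensor: "schwartz f \<Longrightarrow> schwartz g \<Longrightarrow> tensor_sum (\<lambda>W. f (fst W) * g (snd W))"
| add: "tensor_sum H \<Longrightarrow> tensor_sum K \<Longrightarrow> tensor_sum (\<lambda>W. H W + K W)"

lemma
  fixes f :: "'a::euclidean_space \<Rightarrow> complex" and g :: "'b::euclidean_space \<Rightarrow> complex"
  assumes f: "\<And>x. f differentiable (at x)" and g: "\<And>x. g differentiable (at x)"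
  shows differentiable_tensor: "(\<lambda>W. f (fst W) * g (snd W)) differentiable (at W)" (is ?diff)
    and partial_deriv_tensor_fst:
      "partial_deriv (a, 0) (\<lambda>W. f (fst W) * g (snd W)) = (\<lambda>W. partial_deriv a f (fst W) * g (snd W))"
    and partial_deriv_tensor_snd:
      "partial_deriv (0, b) (\<lambda>W. f (fst W) * g (snd W)) = (\<lambda>W. f (fst W) * partial_deriv b g (snd W))"
proof -
  let ?Df = "\<lambda>x. frechet_derivative f (at x)" and ?Dg = "\<lambda>x. frechet_derivative g (at x)"
  have df: "(f has_derivative ?Df x) (at x)" for x using f by (simp add: frechet_derivative_works)
  have dg: "(g has_derivative ?Dg x) (at x)" for x using g by (simp add: frechet_derivative_works)
  have d: "((\<lambda>W. f (fst W) * g (snd W)) has_derivative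
      (\<lambda>h. f (fst W) * ?Dg (snd W) (snd h) + ?Df (fst W) (fst h) * g (snd W))) (at W)" for W
    by (intro has_derivative_mult has_derivative_compose[OF _ df] has_derivative_compose[OF _ dg]
        has_derivative_fst has_derivative_snd has_derivative_ident)
  then show ?diff by (rule differentiableI)
  have "?Df x 0 = 0" "?Dg y 0 = 0" for x y
    using linear_frechet_derivative[OF f] linear_frechet_derivative[OF g] by (auto simp: linear_0)
  with partial_deriv_eq[OF d]
  show "partial_deriv (a, 0) (\<lambda>W. f (fst W) * g (snd W)) = (\<lambda>W. partial_deriv a f (fst W) * g (snd W))"
    and "partial_deriv (0, b) (\<lambda>W. f (fst W) * g (snd W)) = (\<lambda>W. f (fst W) * partial_deriv b g (snd W))"
    by (auto simp: fun_eq_iff) (simp_all add: partial_deriv_def)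
qed

lemma tensor_sum_differentiable: "tensor_sum H \<Longrightarrow> H differentiable (at W)"
  by (induction rule: tensor_sum.induct)
     (auto intro: differentiable_tensor schwartz_differentiable differentiable_add)

lemma tensor_sum_partial_deriv:
  assumes "tensor_sum H" and "b \<in> Basis"
  shows "tensor_sum (partial_deriv (b, 0) H)" and "tensor_sum (partial_deriv (0, b) H)"
proof -
  have "tensor_sum (partial_deriv (b, 0) H) \<and> tensor_sum (partial_deriv (0, b) H)"
    using assms
    by (induction rule: tensor_sum.induct)
       (auto simp: partial_deriv_tensor_fst partial_deriv_tensor_snd schwartz_differentiable
           partial_deriv_add tensor_sum_differentiable intro!: tensor_sum.intros schwartz_partial_deriv)
  then show "tensor_sum (partial_deriv (b, 0) H)" and "tensor_sum (partial_deriv (0, b) H)" by auto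
qed

lemma tensor_sum_uminus: "tensor_sum H \<Longrightarrow> tensor_sum (\<lambda>W. - H W)"
proof (induction rule: tensor_sum.induct)
  case (tensor f g)
  then show ?case using tensor_sum.tensor[OF schwartz_cmult[of f "-1"], of g] by simp
next
  case (add H K)
  then show ?case using tensor_sum.add[of "\<lambda>W. - H W" "\<lambda>W. - K W"] by simp
qed

lemma tensor_sum_sum:
  assumes "\<And>i. i \<in> I \<Longrightarrow> tensor_sum (H i)"
  shows "tensor_sum (\<lambda>W. \<Sum>i\<in>I. H i W)"
proof -
  have 0: "tensor_sum (\<lambda>_. 0 :: complex)"
    using tensor[OF schwartz_zero schwartz_zero] by simp
  show ?thesis
    using assms by (induction I rule: infinite_finite_induct) (auto intro: 0 tensor_sum.add)
qed

lemma tensor_sum_diagonal: "tensor_sum H \<Longrightarrow> schwartz (\<lambda>X. H (X, X))"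
  by (induction rule: tensor_sum.induct) (auto intro: schwartz_mult schwartz_add)

lemma phase_space_Basis:
  "(axis j 1, 0) \<in> (Basis :: 'd::finite phase_space set)" "(0, axis j 1) \<in> (Basis :: 'd phase_space set)"
proof -
  have "axis j 1 \<in> (Basis :: (real ^ 'd) set)" by (simp add: axis_in_Basis_iff)
  then show "(axis j 1, 0) \<in> (Basis :: 'd phase_space set)" "(0, axis j 1) \<in> (Basis :: 'd phase_space set)"
    by (auto simp: Basis_prod_def)
qed

text \<open>Collapses \<open>(0, 0)\<close> to \<open>0\<close>, so that the rules for directions of
  the form \<open>(a, 0)\<close> and \<open>(0, b)\<close> match.\<close>

lemma moyal_op_eq:
  "moyal_op H = (\<lambda>W. (\<Sum>j\<in>UNIV. partial_deriv ((axis j 1, 0), 0) (partial_deriv (0, (0, axis j 1)) H) W)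
     - (\<Sum>j\<in>UNIV. partial_deriv ((0, axis j 1), 0) (partial_deriv (0, (axis j 1, 0)) H) W))"
  by (simp add: fun_eq_iff moyal_op_def zero_prod_def)

lemma tensor_sum_moyal_op:
  assumes "tensor_sum H"
  shows "tensor_sum (moyal_op H)"
  unfolding moyal_op_eq diff_conv_add_uminus
  by (intro tensor_sum.add tensor_sum_uminus tensor_sum_sum tensor_sum_partial_deriv phase_space_Basis assms)

lemma schwartz_weyl_term:
  fixes f g :: "'d::finite phase_space \<Rightarrow> complex"
  assumes "schwartz f" and "schwartz g"
  shows "schwartz (weyl_term n f g)"
proof -
  have "tensor_sum ((moyal_op ^^ n) (\<lambda>(Y, Z). f Y * g Z))"
    by (induction n) (auto simp: case_prod_unfold intro: tensor tensor_sum_moyal_op assms)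
  then show ?thesis
    unfolding weyl_term_def[abs_def] by (intro schwartz_cmult tensor_sum_diagonal)
qed

lemma weyl_term_0: "weyl_term 0 f g X = f X * g X"
  by (simp add: weyl_term_def)

text \<open>The minus sign is a matter of convention: the leading part of \<open>moyal_op\<close>
  differentiates the first factor in position, that of \<open>poisson_bracket\<close> in
  momentum.\<close>

lemma weyl_term_1:
  assumes f: "schwartz f" and g: "schwartz g"
  shows "weyl_term 1 f g X = - (\<i> / 2) * poisson_bracket f g X"
proof -
  have "moyal_op (\<lambda>W. f (fst W) * g (snd W)) (X, X) = - poisson_bracket f g X"
    using assms
    by (simp add: moyal_op_eq poisson_bracket_def partial_deriv_tensor_fst partial_deriv_tensor_snd
        schwartz_differentiable schwartz_partial_deriv phase_space_Basis sum_subtractf)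
  then show ?thesis by (simp add: weyl_term_def case_prod_unfold)
qed

section \<open>Asymptotic expansion\<close>

text \<open>Integration by parts in \<open>s\<close> trades one power of \<open>1 - s\<close> for a
  factor \<open>\<i> * of_real a\<close> and splits off the next Taylor term.\<close>

lemma iexp_Taylor:
  fixes a :: real
  shows "iexp a = (\<Sum>n=0..N. (\<i> * of_real a) ^ n / fact n)
    + (\<i> * of_real a) ^ (N + 1) / fact N * (LBINT s:{0..1}. of_real ((1 - s) ^ N) * iexp (s * a))"
proof (induction N)
  let ?I = "\<lambda>N. LBINT s:{0..1}. complex_of_real ((1 - s) ^ N) * iexp (s * a)"
  have cont: "continuous_on {0..1} (\<lambda>s. complex_of_real ((1 - s) ^ N) * iexp (s * a))" for N
    by (intro continuous_intros)
  have int: "set_integrable lborel {0..1} (\<lambda>s. complex_of_real ((1 - s) ^ N) * iexp (s * a))" for N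
    by (rule borel_integrable_atLeastAtMost'[OF cont])
  have deriv_exp: "((\<lambda>s. iexp (s * a)) has_vector_derivative \<i> * of_real a * iexp (s * a)) (at s within {0..1})" for s
  proof -
    have "((\<lambda>z. exp (\<i> * of_real a * z)) has_field_derivative \<i> * of_real a * exp (\<i> * of_real a * of_real s)) (at (of_real s))"
      by (auto intro!: derivative_eq_intros)
    from has_vector_derivative_real_field[OF this] show ?thesis
      by (simp add: mult.commute mult.left_commute has_vector_derivative_at_within)
  qed
  {
    case 0
    have "(\<integral>s. indicator {0..1} s *\<^sub>R (\<i> * of_real a * iexp (s * a)) \<partial>lborel) = iexp (1 * a) - iexp (0 * a)"
      by (rule integral_FTC_Icc[OF _ deriv_exp]) (auto intro!: continuous_intros)
    then have "\<i> * of_real a * ?I 0 = iexp a - 1"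
      unfolding set_lebesgue_integral_def by (simp flip: mult_scaleR_right)
    then show ?case by simp
  next
    case (Suc N)
    let ?f = "\<lambda>s. \<i> * of_real a * (of_real ((1 - s) ^ Suc N) * iexp (s * a))
      - of_nat (Suc N) * (of_real ((1 - s) ^ N) * iexp (s * a))"
    have d: "((\<lambda>s. complex_of_real ((1 - s) ^ Suc N) * iexp (s * a)) has_vector_derivative ?f s) (at s within {0..1})" for s
    proof -
      have "((\<lambda>s. (1 - s) ^ Suc N) has_real_derivative - (of_nat (Suc N) * (1 - s) ^ N)) (at s within {0..1})"
        using DERIV_power_Suc[OF DERIV_diff[OF DERIV_const[of 1] DERIV_ident], of N s "{0..1}"] by simp
      from has_vector_derivative_mult[OF has_vector_derivative_of_real[OF this] deriv_exp[of s]]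
      show ?thesis by (simp add: algebra_simps)
    qed
    \<comment> \<open>The exponent \<open>Suc N\<close> is positive, so the boundary term at 1
      vanishes; the one at 0 is 1. This gives the recursion between \<open>?I N\<close> and
      \<open>?I (Suc N)\<close>.\<close>
    have "(\<integral>s. indicator {0..1} s *\<^sub>R ?f s \<partial>lborel)
        = complex_of_real ((1 - 1) ^ Suc N) * iexp (1 * a) - complex_of_real ((1 - 0) ^ Suc N) * iexp (0 * a)"
      by (rule integral_FTC_Icc[OF _ d]) (auto intro!: continuous_intros)
    then have "(LBINT s:{0..1}. ?f s) = - 1"
      unfolding set_lebesgue_integral_def by simp
    moreover have "(LBINT s:{0..1}. ?f s) = \<i> * of_real a * ?I (Suc N) - of_nat (Suc N) * ?I N"
      by (simp only: set_integral_diff(2) set_integrable_mult_right int set_integral_mult_right)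
    ultimately have "of_nat (Suc N) * ?I N = 1 + \<i> * of_real a * ?I (Suc N)" by (simp add: algebra_simps)
    then have I: "?I N = (1 + \<i> * of_real a * ?I (Suc N)) / of_nat (Suc N)"
      by (simp add: field_simps del: of_nat_Suc)
    have "(\<i> * of_real a) ^ (N + 1) / fact N * ?I N
      = (\<i> * of_real a) ^ Suc N / fact (Suc N) + (\<i> * of_real a) ^ (Suc N + 1) / fact (Suc N) * ?I (Suc N)"
      unfolding I by (simp add: field_simps del: of_nat_Suc)
    with Suc show ?case by (simp add: add.assoc)
  }
qed

section \<open>Fourier integrals on the doubled phase space\<close>

text \<open>The unnormalised symplectic Fourier transform for the form \<sigma> \<oplus> \<sigma>. A
  single integral over pairs is differentiated in one stroke; Fubini enters only when it is compared
  with the iterated integrals of the theorem.\<close>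

definition double_wave ::
  "('d::finite phase_space \<times> 'd phase_space \<Rightarrow> complex) \<Rightarrow> 'd phase_space \<times> 'd phase_space \<Rightarrow> complex" where
  "double_wave K W = (\<integral>V. iexp (sympl (fst W) (fst V) + sympl (snd W) (snd V)) * K V \<partial>lborel)"

lemma double_sympl_eq_inner:
  "sympl (fst W) (fst V) + sympl (snd W) (snd V) = (sympl_map (fst W), sympl_map (snd W)) \<bullet> V"
  by (simp add: sympl_eq_inner inner_prod_def)

lemma bounded_linear_double_sympl_map:
  "bounded_linear (\<lambda>W. (sympl_map (fst W), sympl_map (snd W)))"
  unfolding linear_conv_bounded_linear[symmetric]
  by (rule linearI) (simp_all add: linear_add[OF linear_sympl_map] linear_cmul[OF linear_sympl_map])

lemma integrable_double_wave:
  fixes K :: "'d::finite phase_space \<times> 'd phase_space \<Rightarrow> complex"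
  assumes "rapid K"
  shows "integrable lborel (\<lambda>V. iexp (sympl (fst W) (fst V) + sympl (snd W) (snd V)) * K V)"
proof (rule rapid_integrable[OF assms])
  show "norm (iexp (sympl (fst W) (fst V) + sympl (snd W) (snd V))) \<le> 1 * (1 + norm V) ^ 0" for V
    by simp
qed (simp add: double_sympl_eq_inner)

lemma partial_deriv_double_wave:
  fixes K :: "'d::finite phase_space \<times> 'd phase_space \<Rightarrow> complex"
  assumes "rapid K"
  shows "partial_deriv w (double_wave K)
    = double_wave (\<lambda>V. \<i> * of_real (sympl (fst w) (fst V) + sympl (snd w) (snd V)) * K V)"
proof
  fix W
  \<comment> \<open>The constant amplitude \<open>G = 1\<close> makes the wave integral a pure
    Fourier integral, and only the derivative of the phase survives.\<close>
  have "((\<lambda>x. \<integral>y. iexp ((sympl_map (fst x), sympl_map (snd x)) \<bullet> y) * K y * 1 \<partial>lborel) has_derivative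
     (\<lambda>h. \<integral>y. iexp ((sympl_map (fst W), sympl_map (snd W)) \<bullet> y) * K y *
       (\<i> * of_real ((sympl_map (fst h), sympl_map (snd h)) \<bullet> y) * 1 + 0) \<partial>lborel)) (at W)"
    by (rule wave_integral_has_derivative[OF bounded_linear_double_sympl_map assms,
          where G = "\<lambda>_. 1" and C = 1 and D = 0 and c = 0 and G' = "\<lambda>_ _. 0"]) auto
  from partial_deriv_eq[OF this, of w]
  show "partial_deriv w (double_wave K) W
    = double_wave (\<lambda>V. \<i> * of_real (sympl (fst w) (fst V) + sympl (snd w) (snd V)) * K V) W"
    unfolding double_wave_def[abs_def] double_sympl_eq_inner by (simp only: mult_1_left mult_1_right add_0_right mult_ac)
qed

lemma rapid_double_sympl:
  fixes K :: "'d::finite phase_space \<times> 'd phase_space \<Rightarrow> complex"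
  assumes "rapid K"
  shows "rapid (\<lambda>V. \<i> * of_real (sympl (fst w) (fst V) + sympl (snd w) (snd V)) * K V)"
  unfolding double_sympl_eq_inner using assms by (rule rapid_inner)

lemma moyal_op_double_wave:
  fixes K :: "'d::finite phase_space \<times> 'd phase_space \<Rightarrow> complex"
  assumes K: "rapid K"
  shows "moyal_op (double_wave K) = double_wave (\<lambda>V. of_real (sympl (fst V) (snd V)) * K V)"
proof
  fix W :: "'d phase_space \<times> 'd phase_space"
  let ?ph = "\<lambda>w V :: 'd phase_space \<times> 'd phase_space. \<i> * complex_of_real (sympl (fst w) (fst V) + sympl (snd w) (snd V))"
  let ?e = "\<lambda>V :: 'd phase_space \<times> 'd phase_space. iexp (sympl (fst W) (fst V) + sympl (snd W) (snd V))"
  let ?P = "\<lambda>j V. ?ph ((axis j 1, 0), 0) V * (?ph (0, (0, axis j 1)) V * K V)"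
  let ?Q = "\<lambda>j V. ?ph ((0, axis j 1), 0) V * (?ph (0, (axis j 1, 0)) V * K V)"
  have rapid: "rapid (\<lambda>V. ?ph w V * (?ph w' V * K V))" for w w'
    by (intro rapid_double_sympl K)
  have "moyal_op (double_wave K) W = (\<Sum>j\<in>UNIV. double_wave (?P j) W) - (\<Sum>j\<in>UNIV. double_wave (?Q j) W)"
    by (simp only: moyal_op_eq partial_deriv_double_wave[OF K] partial_deriv_double_wave[OF rapid_double_sympl[OF K]])
  also have "(\<Sum>j\<in>UNIV. double_wave (?P j) W) = (\<integral>V. (\<Sum>j\<in>UNIV. ?e V * ?P j V) \<partial>lborel)"
    unfolding double_wave_def
    by (rule Bochner_Integration.integral_sum[symmetric]) (rule integrable_double_wave[OF rapid])
  also have "(\<Sum>j\<in>UNIV. double_wave (?Q j) W) = (\<integral>V. (\<Sum>j\<in>UNIV. ?e V * ?Q j V) \<partial>lborel)"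
    unfolding double_wave_def
    by (rule Bochner_Integration.integral_sum[symmetric]) (rule integrable_double_wave[OF rapid])
  also have "(\<integral>V. (\<Sum>j\<in>UNIV. ?e V * ?P j V) \<partial>lborel) - (\<integral>V. (\<Sum>j\<in>UNIV. ?e V * ?Q j V) \<partial>lborel)
      = (\<integral>V. (\<Sum>j\<in>UNIV. ?e V * ?P j V) - (\<Sum>j\<in>UNIV. ?e V * ?Q j V) \<partial>lborel)"
    by (rule Bochner_Integration.integral_diff[symmetric])
       (rule Bochner_Integration.integrable_sum, rule integrable_double_wave[OF rapid])+
  also have "\<dots> = double_wave (\<lambda>V. of_real (sympl (fst V) (snd V)) * K V) W"
  proof -
    have "(\<Sum>j\<in>UNIV. ?e V * ?P j V) - (\<Sum>j\<in>UNIV. ?e V * ?Q j V)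
        = ?e V * (of_real (sympl (fst V) (snd V)) * K V)" for V
    proof -
      obtain y \<eta> z \<zeta> where V: "V = ((y, \<eta>), (z, \<zeta>))" by (metis surj_pair)
      have ii: "\<i> * a * (\<i> * b * k) = - (a * b * k)" for a b k
      proof -
        have "\<i> * a * (\<i> * b * k) = (\<i> * \<i>) * (a * b * k)" by (simp only: mult_ac)
        then show ?thesis by simp
      qed
      \<comment> \<open>The position derivative in the first slot yields
        \<open>- (\<eta> $ j)\<close>, the momentum derivative in the second \<open>z $ j\<close>;
        the sign of \<open>ii\<close> makes the product positive. In \<open>Q\<close> the minus sign
        sits on \<open>\<zeta> $ j\<close> instead. The difference sums to \<sigma>.\<close>
      have P: "?P j V = of_real (\<eta> $ j * z $ j) * K V" for j
        by (simp add: V sympl_def inner_axis inner_axis' ii)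
      have Q: "?Q j V = of_real (y $ j * \<zeta> $ j) * K V" for j
        by (simp add: V sympl_def inner_axis inner_axis' ii)
      have "(\<Sum>j\<in>UNIV. ?e V * ?P j V) - (\<Sum>j\<in>UNIV. ?e V * ?Q j V)
        = ?e V * ((\<Sum>j\<in>UNIV. of_real (\<eta> $ j * z $ j)) * K V - (\<Sum>j\<in>UNIV. of_real (y $ j * \<zeta> $ j)) * K V)"
        unfolding P Q by (simp only: sum_distrib_left[symmetric] sum_distrib_right[symmetric] right_diff_distrib)
      also have "\<dots> = ?e V * (of_real (sympl (fst V) (snd V)) * K V)"
        by (simp add: V sympl_def inner_vec_def left_diff_distrib)
      finally show ?thesis .
    qed
    then show ?thesis unfolding double_wave_def by (simp only:)
  qed
  finally show "moyal_op (double_wave K) W = double_wave (\<lambda>V. of_real (sympl (fst V) (snd V)) * K V) W" .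
qed

text \<open>\<sigma> grows quadratically in the pair \<open>V\<close>, hence the exponent
  \<open>2 * n\<close> in the proof. The function \<open>p\<close> will be a power, a phase
  (\<open>n = 0\<close>) or the Taylor remainder.\<close>

lemma rapid_mult_sympl_bounded:
  fixes K :: "'d::finite phase_space \<times> 'd phase_space \<Rightarrow> complex"
  assumes "rapid K" and [measurable]: "p \<in> borel_measurable borel"
    and p: "\<And>t. norm (p t) \<le> \<bar>t\<bar> ^ n"
  shows "rapid (\<lambda>V. p (sympl (fst V) (snd V)) * K V)"
proof (rule rapid_mult[OF assms(1)])
  show "(\<lambda>V::'d phase_space \<times> 'd phase_space. p (sympl (fst V) (snd V))) \<in> borel_measurable borel"
  proof -
    have "continuous_on UNIV (\<lambda>V::'d phase_space \<times> 'd phase_space. sympl (fst V) (snd V))"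
      unfolding sympl_def by (intro continuous_intros)
    from measurable_compose[OF borel_measurable_continuous_onI[OF this] assms(2)] show ?thesis .
  qed
  show "norm (p (sympl (fst V) (snd V))) \<le> 1 * (1 + norm V) ^ (2 * n)" for V :: "'d phase_space \<times> 'd phase_space"
  proof -
    have "\<bar>sympl (fst V) (snd V)\<bar> \<le> (1 + norm V) * (1 + norm V)"
      using norm_fst_le[of "fst V" "snd V"] norm_snd_le[of "snd V" "fst V"]
      by (intro order_trans[OF abs_sympl_le] mult_mono) auto
    then have "\<bar>sympl (fst V) (snd V)\<bar> ^ n \<le> ((1 + norm V) * (1 + norm V)) ^ n"
      by (rule power_mono) simp
    with p[of "sympl (fst V) (snd V)"] show ?thesis
      by (simp add: power_mult power2_eq_square)
  qed
qed

lemma rapid_mult_sympl_power: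
  fixes K :: "'d::finite phase_space \<times> 'd phase_space \<Rightarrow> complex"
  assumes "rapid K"
  shows "rapid (\<lambda>V. of_real (sympl (fst V) (snd V)) ^ n * K V)"
  by (rule rapid_mult_sympl_bounded[OF assms, where p = "\<lambda>t. of_real t ^ n" and n = n])
     (auto simp: norm_power)

lemma moyal_op_power_double_wave:
  fixes K :: "'d::finite phase_space \<times> 'd phase_space \<Rightarrow> complex"
  assumes "rapid K"
  shows "(moyal_op ^^ n) (double_wave K) = double_wave (\<lambda>V. of_real (sympl (fst V) (snd V)) ^ n * K V)"
  by (induction n) (simp_all add: moyal_op_double_wave[OF rapid_mult_sympl_power[OF assms]] mult.assoc)

lemma integral_lborel_iterated:
  fixes k :: "'a::euclidean_space \<times> 'b::euclidean_space \<Rightarrow> complex"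
  assumes "integrable lborel k"
  shows "(\<integral>V. k V \<partial>lborel) = (\<integral>Y. (\<integral>Z. k (Y, Z) \<partial>lborel) \<partial>lborel)"
  using lborel_pair.integral_fst'[of k] assms by (simp add: lborel_prod)

text \<open>The joint weight \<open>1 + norm V\<close> is dominated by the product of the weights in
  the two slots, so the moments of the tensor product are controlled by products of moments.\<close>

lemma rapid_tensor:
  fixes F :: "'a::euclidean_space \<Rightarrow> complex" and G :: "'b::euclidean_space \<Rightarrow> complex"
  assumes F: "rapid F" and G: "rapid G"
  shows "rapid (\<lambda>V. F (fst V) * G (snd V))"
  unfolding rapid_def
proof (intro conjI allI)
  have [measurable]: "F \<in> borel_measurable borel" "G \<in> borel_measurable borel"
    using F G by (auto simp: rapid_def)
  have "(\<lambda>V. F (fst V) * G (snd V)) \<in> borel_measurable (borel \<Otimes>\<^sub>M borel)" by measurable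
  then show meas [measurable]: "(\<lambda>V. F (fst V) * G (snd V)) \<in> borel_measurable borel"
    by (simp add: borel_prod)
  fix k
  let ?w = "\<lambda>V. ((1 + norm (fst V)) ^ k * norm (F (fst V))) * ((1 + norm (snd V)) ^ k * norm (G (snd V)))"
  show "integrable lborel (\<lambda>V. (1 + norm V) ^ k * norm (F (fst V) * G (snd V)))"
  proof (rule Bochner_Integration.integrable_bound)
    show "integrable lborel ?w"
      using integrable_tensor[of "\<lambda>y. (1 + norm y) ^ k * norm (F y)" "\<lambda>z. (1 + norm z) ^ k * norm (G z)"] F G
      by (simp add: rapid_def lborel_prod case_prod_unfold)
    show "AE V in lborel. norm ((1 + norm V) ^ k * norm (F (fst V) * G (snd V))) \<le> norm (?w V)"
    proof (rule AE_I2)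
      fix V :: "'a \<times> 'b"
      have "1 + norm V \<le> (1 + norm (fst V)) * (1 + norm (snd V))"
      proof -
        have "norm V \<le> norm (fst V) + norm (snd V)" using norm_Pair_le[of "fst V" "snd V"] by simp
        moreover have "0 \<le> norm (fst V) * norm (snd V)" by simp
        ultimately show ?thesis unfolding distrib_left distrib_right by linarith
      qed
      then have "(1 + norm V) ^ k \<le> ((1 + norm (fst V)) * (1 + norm (snd V))) ^ k"
        by (intro power_mono) auto
      from mult_right_mono[OF this norm_ge_zero[of "F (fst V) * G (snd V)"]]
      have "(1 + norm V) ^ k * norm (F (fst V) * G (snd V)) \<le> ?w V"
        by (simp only: power_mult_distrib norm_mult mult_ac)
      then show "norm ((1 + norm V) ^ k * norm (F (fst V) * G (snd V))) \<le> norm (?w V)"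
        by (simp add: norm_mult abs_mult)
    qed
  qed measurable
qed

section \<open>The scalar Taylor remainder\<close>

text \<open>The multiplier in \<open>weyl_remainder\<close> as a function of
  \<open>t = sympl Y Z\<close>. Its power of \<open>\<epsilon>\<close> has been taken out, so that
  bounds uniform in \<open>\<epsilon>\<close> are possible.\<close>

definition taylor_remainder :: "real \<Rightarrow> nat \<Rightarrow> real \<Rightarrow> complex" where
  "taylor_remainder \<epsilon> N t = (1 / fact N * (\<i> ^ (N + 1) / 2 ^ (N + 1))) * of_real t ^ (N + 1) *
     (LBINT s:{0..1}. of_real ((1 - s) ^ N) * iexp (s * (\<epsilon> / 2) * t))"

lemma scaled_exp_term:
  "(\<i> * of_real (\<epsilon> / 2 * t)) ^ n / fact n = of_real \<epsilon> ^ n * (1 / fact n * (\<i> ^ n / 2 ^ n)) * of_real t ^ n"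
  by (simp add: power_mult_distrib power_divide field_simps)

lemma iexp_eq_taylor_remainder:
  "iexp (\<epsilon> / 2 * t) = (\<Sum>n=0..N. of_real \<epsilon> ^ n * (1 / fact n * (\<i> ^ n / 2 ^ n)) * of_real t ^ n)
    + of_real \<epsilon> ^ (N + 1) * taylor_remainder \<epsilon> N t"
proof -
  have "(\<i> * of_real (\<epsilon> / 2 * t)) ^ (N + 1) / fact N * I
      = of_real \<epsilon> ^ (N + 1) * ((1 / fact N * (\<i> ^ (N + 1) / 2 ^ (N + 1))) * of_real t ^ (N + 1) * I)" for I
    by (simp add: power_mult_distrib power_divide field_simps)
  then show ?thesis
    unfolding iexp_Taylor[of "\<epsilon> / 2 * t" N] taylor_remainder_def scaled_exp_term by (simp only: mult.assoc)
qed

text \<open>Solving the Taylor identity for the remainder replaces a parameter integral by a closed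
  expression that is visibly continuous in \<open>t\<close>; measurability follows.\<close>

lemma taylor_remainder_eq:
  assumes "\<epsilon> \<noteq> 0"
  shows "taylor_remainder \<epsilon> N t = (iexp (\<epsilon> / 2 * t)
    - (\<Sum>n=0..N. of_real \<epsilon> ^ n * (1 / fact n * (\<i> ^ n / 2 ^ n)) * of_real t ^ n)) / of_real \<epsilon> ^ (N + 1)"
  using assms unfolding iexp_eq_taylor_remainder[of \<epsilon> t N] by simp

lemma borel_measurable_taylor_remainder:
  assumes "\<epsilon> \<noteq> 0"
  shows "taylor_remainder \<epsilon> N \<in> borel_measurable borel"
proof -
  have "continuous_on UNIV (taylor_remainder \<epsilon> N)"
    unfolding taylor_remainder_eq[OF assms, abs_def]
    using assms by (intro continuous_intros) auto
  then show ?thesis by (rule borel_measurable_continuous_onI)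
qed

text \<open>The error of the Taylor polynomial, estimated by \<open>iexp_approx1\<close>, is the
  remainder times \<open>\<epsilon> ^ (N + 1)\<close>; the same power of
  \<open>\<bar>\<epsilon>\<bar>\<close> stands in the estimate and cancels.\<close>

lemma norm_taylor_remainder_le:
  assumes "\<epsilon> \<noteq> 0"
  shows "norm (taylor_remainder \<epsilon> N t) \<le> \<bar>t\<bar> ^ (N + 1)"
proof -
  have "norm (iexp (\<epsilon> / 2 * t) - (\<Sum>n=0..N. of_real \<epsilon> ^ n * (1 / fact n * (\<i> ^ n / 2 ^ n)) * of_real t ^ n))
      \<le> \<bar>\<epsilon> / 2 * t\<bar> ^ Suc N / fact (Suc N)"
    using iexp_approx1[of "\<epsilon> / 2 * t" N] by (simp only: atLeast0AtMost scaled_exp_term)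
  \<comment> \<open>Only independence of \<open>\<epsilon>\<close> matters for the final bound, so
    the factorial is given away here and the power of 2 in the next step.\<close>
  also have "\<dots> \<le> \<bar>\<epsilon> / 2 * t\<bar> ^ Suc N / 1"
    by (intro divide_left_mono) (simp_all add: fact_ge_1 del: fact_Suc)
  also have "\<dots> \<le> (\<bar>\<epsilon>\<bar> * \<bar>t\<bar>) ^ Suc N"
    by (simp only: div_by_1) (intro power_mono, simp_all add: abs_mult)
  finally have "norm (of_real \<epsilon> ^ (N + 1) * taylor_remainder \<epsilon> N t) \<le> (\<bar>\<epsilon>\<bar> * \<bar>t\<bar>) ^ Suc N"
    by (simp only: iexp_eq_taylor_remainder[of \<epsilon> t N] add_diff_cancel_left')
  then have "\<bar>\<epsilon>\<bar> ^ (N + 1) * norm (taylor_remainder \<epsilon> N t) \<le> \<bar>\<epsilon>\<bar> ^ (N + 1) * \<bar>t\<bar> ^ (N + 1)"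
    unfolding norm_mult norm_power norm_of_real power_mult_distrib Suc_eq_plus1 .
  then show ?thesis
    by (rule mult_left_le_imp_le) (use assms in simp)
qed

definition weyl_kernel ::
  "('d::finite phase_space \<Rightarrow> complex) \<Rightarrow> ('d phase_space \<Rightarrow> complex) \<Rightarrow> 'd phase_space \<times> 'd phase_space \<Rightarrow> complex" where
  "weyl_kernel f g V = 1 / (2 * of_real pi) ^ (2 * CARD('d)) * (sympl_fourier f (fst V) * sympl_fourier g (snd V))"

lemma rapid_weyl_kernel:
  fixes f g :: "'d::finite phase_space \<Rightarrow> complex"
  assumes "schwartz f" and "schwartz g"
  shows "rapid (weyl_kernel f g)"
  unfolding weyl_kernel_def[abs_def]
  by (rule rapid_mult[where m = 0 and C = "norm (1 / (2 * of_real pi) ^ (2 * CARD('d)) :: complex)"])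
     (auto intro!: rapid_tensor rapid_sympl_fourier assms)

lemma double_wave_weyl_kernel:
  fixes f g :: "'d::finite phase_space \<Rightarrow> complex"
  assumes f: "schwartz f" and g: "schwartz g"
  shows "double_wave (weyl_kernel f g) = (\<lambda>(Y, Z). f Y * g Z)"
proof
  fix W :: "'d phase_space \<times> 'd phase_space"
  let ?c = "(2 * of_real pi) ^ CARD('d) :: complex"
  have eq: "iexp (sympl (fst W) Y + sympl (snd W) Z) * weyl_kernel f g (Y, Z)
    = 1 / (?c * ?c) * (iexp (sympl (fst W) Y) * sympl_fourier f Y) * (iexp (sympl (snd W) Z) * sympl_fourier g Z)" for Y Z
  proof -
    have "iexp (sympl (fst W) Y + sympl (snd W) Z) = iexp (sympl (fst W) Y) * iexp (sympl (snd W) Z)"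
      by (simp add: distrib_left exp_add)
    moreover have "weyl_kernel f g (Y, Z) = 1 / (?c * ?c) * (sympl_fourier f Y * sympl_fourier g Z)"
      by (simp add: weyl_kernel_def mult_2[of "CARD('d)"] power_add)
    ultimately show ?thesis by (simp only: mult_ac)
  qed
  have "double_wave (weyl_kernel f g) W
    = (\<integral>Y. (\<integral>Z. iexp (sympl (fst W) Y + sympl (snd W) Z) * weyl_kernel f g (Y, Z) \<partial>lborel) \<partial>lborel)"
    unfolding double_wave_def
    by (subst integral_lborel_iterated[OF integrable_double_wave[OF rapid_weyl_kernel[OF assms]]]) simp
  also have "\<dots> = 1 / (?c * ?c) * (?c * f (fst W)) * (?c * g (snd W))"
    unfolding eq integral_mult_right_zero integral_mult_left_zero
      sympl_fourier_inversion[OF f] sympl_fourier_inversion[OF g] ..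
  also have "\<dots> = f (fst W) * g (snd W)" by simp
  finally show "double_wave (weyl_kernel f g) W = (case W of (Y, Z) \<Rightarrow> f Y * g Z)"
    by (simp add: case_prod_unfold)
qed

lemma weyl_term_eq_double_wave:
  fixes f g :: "'d::finite phase_space \<Rightarrow> complex"
  assumes "schwartz f" and "schwartz g"
  shows "weyl_term n f g X = 1 / fact n * (\<i> ^ n / 2 ^ n) *
    double_wave (\<lambda>V. of_real (sympl (fst V) (snd V)) ^ n * weyl_kernel f g V) (X, X)"
  unfolding weyl_term_def double_wave_weyl_kernel[OF assms, symmetric]
    moyal_op_power_double_wave[OF rapid_weyl_kernel[OF assms]] ..

text \<open>Both \<open>weyl_prod\<close> and \<open>weyl_remainder\<close> are iterated integrals
  of this shape for a suitable \<open>p\<close>. Joint integrability, supplied by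
  \<open>rapid\<close>, lets Fubini merge the two integrals into one.\<close>

lemma double_wave_diagonal:
  fixes f g :: "'d::finite phase_space \<Rightarrow> complex"
  assumes "rapid (\<lambda>V. p (sympl (fst V) (snd V)) * weyl_kernel f g V)"
  shows "double_wave (\<lambda>V. p (sympl (fst V) (snd V)) * weyl_kernel f g V) (X, X)
    = 1 / (2 * of_real pi) ^ (2 * CARD('d)) *
      (\<integral>Y. (\<integral>Z. iexp (sympl X (Y + Z)) * p (sympl Y Z) * sympl_fourier f Y * sympl_fourier g Z \<partial>lborel) \<partial>lborel)"
proof -
  have eq: "iexp (sympl X Y + sympl X Z) * (p (sympl Y Z) * weyl_kernel f g (Y, Z))
    = 1 / (2 * of_real pi) ^ (2 * CARD('d)) * (iexp (sympl X (Y + Z)) * p (sympl Y Z) * sympl_fourier f Y * sympl_fourier g Z)" for Y Z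
    unfolding weyl_kernel_def sympl_add_right fst_conv snd_conv by (simp only: mult_ac)
  show ?thesis
    unfolding double_wave_def integral_mult_right_zero[symmetric] eq[symmetric]
    using integral_lborel_iterated[OF integrable_double_wave[OF assms, of "(X, X)"]] by (simp only: fst_conv snd_conv)
qed

lemma weyl_prod_eq_double_wave:
  fixes f g :: "'d::finite phase_space \<Rightarrow> complex"
  assumes "schwartz f" and "schwartz g"
  shows "weyl_prod \<epsilon> f g X = double_wave (\<lambda>V. iexp (\<epsilon> / 2 * sympl (fst V) (snd V)) * weyl_kernel f g V) (X, X)"
  unfolding weyl_prod_def
  by (rule double_wave_diagonal[where p = "\<lambda>t. iexp (\<epsilon> / 2 * t)", symmetric])
     (rule rapid_mult_sympl_bounded[OF rapid_weyl_kernel[OF assms], where p = "\<lambda>t. iexp (\<epsilon> / 2 * t)" and n = 0], auto)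

lemma rapid_taylor_remainder:
  assumes "schwartz f" and "schwartz g" and "\<epsilon> \<noteq> 0"
  shows "rapid (\<lambda>V. taylor_remainder \<epsilon> N (sympl (fst V) (snd V)) * weyl_kernel f g V)"
  using rapid_weyl_kernel[OF assms(1,2)] borel_measurable_taylor_remainder[OF assms(3)] norm_taylor_remainder_le[OF assms(3)]
  by (rule rapid_mult_sympl_bounded)

lemma weyl_remainder_eq_double_wave:
  fixes f g :: "'d::finite phase_space \<Rightarrow> complex"
  assumes "schwartz f" and "schwartz g" and "\<epsilon> \<noteq> 0"
  shows "weyl_remainder \<epsilon> N f g X
    = double_wave (\<lambda>V. taylor_remainder \<epsilon> N (sympl (fst V) (snd V)) * weyl_kernel f g V) (X, X)"
  unfolding double_wave_diagonal[where p = "taylor_remainder \<epsilon> N", OF rapid_taylor_remainder[OF assms]]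
  unfolding weyl_remainder_def taylor_remainder_def
  by (simp only: mult.assoc)

lemma weyl_prod_expansion:
  fixes f g :: "'d::finite phase_space \<Rightarrow> complex"
  assumes f: "schwartz f" and g: "schwartz g" and \<epsilon>: "\<epsilon> \<noteq> 0"
  shows "weyl_prod \<epsilon> f g X =
    (\<Sum>n=0..N. of_real \<epsilon> ^ n * weyl_term n f g X) + of_real \<epsilon> ^ (N + 1) * weyl_remainder \<epsilon> N f g X"
proof -
  let ?e = "\<lambda>V. iexp (sympl X (fst V) + sympl X (snd V))" and ?s = "\<lambda>V. sympl (fst V) (snd V)"
  let ?c = "\<lambda>n. of_real \<epsilon> ^ n * (1 / fact n * (\<i> ^ n / 2 ^ n)) :: complex"
  let ?K = "weyl_kernel f g" and ?R = "taylor_remainder \<epsilon> N"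
  have int_term: "integrable lborel (\<lambda>V. ?e V * (of_real (?s V) ^ n * ?K V))" for n
    using integrable_double_wave[OF rapid_mult_sympl_power[OF rapid_weyl_kernel[OF f g]], of "(X, X)"] by simp
  have int_rem: "integrable lborel (\<lambda>V. ?e V * (?R (?s V) * ?K V))"
    using integrable_double_wave[OF rapid_taylor_remainder[OF f g \<epsilon>], of "(X, X)"] by simp
  have "?e V * (iexp (\<epsilon> / 2 * ?s V) * ?K V) = (\<Sum>n=0..N. ?c n * (?e V * (of_real (?s V) ^ n * ?K V)))
      + of_real \<epsilon> ^ (N + 1) * (?e V * (?R (?s V) * ?K V))" for V
    unfolding iexp_eq_taylor_remainder[of \<epsilon> "?s V" N] distrib_left distrib_right sum_distrib_left sum_distrib_right
    by (simp only: mult_ac)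
  then have "weyl_prod \<epsilon> f g X = (\<integral>V. (\<Sum>n=0..N. ?c n * (?e V * (of_real (?s V) ^ n * ?K V)))
      + of_real \<epsilon> ^ (N + 1) * (?e V * (?R (?s V) * ?K V)) \<partial>lborel)"
    unfolding weyl_prod_eq_double_wave[OF f g] double_wave_def fst_conv snd_conv by (simp only:)
  also have "\<dots> = (\<integral>V. (\<Sum>n=0..N. ?c n * (?e V * (of_real (?s V) ^ n * ?K V))) \<partial>lborel)
      + (\<integral>V. of_real \<epsilon> ^ (N + 1) * (?e V * (?R (?s V) * ?K V)) \<partial>lborel)"
    by (intro Bochner_Integration.integral_add Bochner_Integration.integrable_sum integrable_mult_right int_term int_rem)
  also have "(\<integral>V. (\<Sum>n=0..N. ?c n * (?e V * (of_real (?s V) ^ n * ?K V))) \<partial>lborel)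
      = (\<Sum>n=0..N. \<integral>V. ?c n * (?e V * (of_real (?s V) ^ n * ?K V)) \<partial>lborel)"
    by (intro Bochner_Integration.integral_sum integrable_mult_right int_term)
  finally show ?thesis
    unfolding weyl_term_eq_double_wave[OF f g] weyl_remainder_eq_double_wave[OF f g \<epsilon>] double_wave_def
      fst_conv snd_conv integral_mult_right_zero mult.assoc .
qed

lemma schwartz_weyl_remainder:
  fixes f g :: "'d::finite phase_space \<Rightarrow> complex"
  assumes f: "schwartz f" and g: "schwartz g" and \<epsilon>: "\<epsilon> \<noteq> 0" "\<bar>\<epsilon>\<bar> \<le> 2"
  shows "schwartz (weyl_remainder \<epsilon> N f g)"
proof -
  \<comment> \<open>The subtraction is written as a sum with negative coefficients, to match closure
    under sums and scalar multiples.\<close>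
  let ?S = "\<lambda>X. weyl_prod \<epsilon> f g X + (\<Sum>n=0..N. - (of_real \<epsilon> ^ n) * weyl_term n f g X)"
  have nz: "complex_of_real \<epsilon> ^ (N + 1) \<noteq> 0" using \<epsilon> by simp
  have "?S X = of_real \<epsilon> ^ (N + 1) * weyl_remainder \<epsilon> N f g X" for X
    unfolding weyl_prod_expansion[OF f g \<epsilon>(1), of X N] mult_minus_left sum_negf by (simp only: add_diff_cancel_left' flip: diff_conv_add_uminus)
  then have "weyl_remainder \<epsilon> N f g = (\<lambda>X. inverse (of_real \<epsilon> ^ (N + 1)) * ?S X)"
    by (simp only: mult.assoc[symmetric] left_inverse[OF nz] mult_1_left)
  then show ?thesis
    by (simp only:) (intro schwartz_cmult schwartz_add schwartz_sum schwartz_weyl_prod schwartz_weyl_term f g \<epsilon>)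
qed

lemma weyl_prod_bigo:
  fixes f g :: "'d::finite phase_space \<Rightarrow> complex"
  assumes f: "schwartz f" and g: "schwartz g"
  shows "(\<lambda>\<epsilon>::real. weyl_prod \<epsilon> f g X - (\<Sum>n=0..N. of_real \<epsilon> ^ n * weyl_term n f g X))
    \<in> O[at_right 0](\<lambda>\<epsilon>. of_real \<epsilon> ^ (N + 1))"
proof -
  \<comment> \<open>Its integral, an absolute moment of \<sigma> against the kernel, becomes the
    Landau constant. It involves neither \<open>\<epsilon>\<close> nor \<open>X\<close>, so the same
    constant serves at every point.\<close>
  let ?B = "\<lambda>V. norm (of_real (sympl (fst V) (snd V)) ^ (N + 1) * weyl_kernel f g V)"
  have B: "integrable lborel ?B"
    by (intro integrable_norm rapid_integrable_self rapid_mult_sympl_power rapid_weyl_kernel f g)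
  have "norm (weyl_remainder \<epsilon> N f g X) \<le> integral\<^sup>L lborel ?B" if \<epsilon>: "\<epsilon> \<noteq> 0" for \<epsilon>
    unfolding weyl_remainder_eq_double_wave[OF f g \<epsilon>] double_wave_def
  proof (rule Bochner_Integration.integral_norm_bound_integral[OF integrable_double_wave[OF rapid_taylor_remainder[OF f g \<epsilon>]] B])
    fix V :: "'d phase_space \<times> 'd phase_space"
    have "norm (taylor_remainder \<epsilon> N (sympl (fst V) (snd V)) * weyl_kernel f g V)
      \<le> norm (of_real (sympl (fst V) (snd V)) ^ (N + 1) * weyl_kernel f g V)"
      unfolding norm_mult norm_power norm_of_real
      by (intro mult_right_mono norm_taylor_remainder_le \<epsilon> norm_ge_zero)
    then show "norm (iexp (sympl (fst (X, X)) (fst V) + sympl (snd (X, X)) (snd V)) *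
        (taylor_remainder \<epsilon> N (sympl (fst V) (snd V)) * weyl_kernel f g V)) \<le> ?B V"
      by (subst norm_mult) simp
  qed
  then have bound: "norm (weyl_prod \<epsilon> f g X - (\<Sum>n=0..N. of_real \<epsilon> ^ n * weyl_term n f g X))
      \<le> integral\<^sup>L lborel ?B * norm (of_real \<epsilon> ^ (N + 1) :: complex)" if "\<epsilon> \<noteq> 0" for \<epsilon>
    using that unfolding weyl_prod_expansion[OF f g that, of X N]
    by (simp add: norm_mult mult.commute mult_left_mono)
  show ?thesis
  proof (rule bigoI)
    show "\<forall>\<^sub>F \<epsilon> in at_right 0. norm (weyl_prod \<epsilon> f g X - (\<Sum>n=0..N. of_real \<epsilon> ^ n * weyl_term n f g X))
      \<le> integral\<^sup>L lborel ?B * norm (of_real \<epsilon> ^ (N + 1) :: complex)"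
      by (rule eventually_at_rightI[of 0 1]) (use bound in auto)
  qed
qed

theorem theorem6p24:
  fixes f g :: "(real ^ 'd) \<times> (real ^ 'd) \<Rightarrow> complex"
  assumes "schwartz f" and "schwartz g"
  shows "(\<forall>n. schwartz (weyl_term n f g)) \<and>
         (\<forall>N. (\<forall>\<epsilon>::real. 0 < \<epsilon> \<and> \<epsilon> < 1 \<longrightarrow>
                  schwartz (weyl_remainder \<epsilon> N f g) \<and>
                  (\<forall>X. weyl_prod \<epsilon> f g X =
                         (\<Sum>n = 0..N. of_real \<epsilon> ^ n * weyl_term n f g X) +
                         of_real \<epsilon> ^ (N + 1) * weyl_remainder \<epsilon> N f g X)) \<and>
              (\<forall>X. (\<lambda>\<epsilon>::real. weyl_prod \<epsilon> f g X -
                         (\<Sum>n = 0..N. of_real \<epsilon> ^ n * weyl_term n f g X))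
                     \<in> O[at_right 0](\<lambda>\<epsilon>. of_real \<epsilon> ^ (N + 1)))) \<and>
         (\<forall>X. weyl_term 0 f g X = f X * g X) \<and>
         (\<forall>X. weyl_term 1 f g X = - (\<i> / 2) * poisson_bracket f g X) \<and>
         (\<forall>X. (\<lambda>\<epsilon>::real. weyl_prod \<epsilon> f g X -
                   (f X * g X - of_real \<epsilon> * (\<i> / 2) * poisson_bracket f g X))
               \<in> O[at_right 0](\<lambda>\<epsilon>. of_real \<epsilon> ^ 2))"
proof (intro conjI allI impI)
  fix N :: nat and \<epsilon> :: real and X
  assume "0 < \<epsilon> \<and> \<epsilon> < 1"
  then have \<epsilon>: "\<epsilon> \<noteq> 0" "\<bar>\<epsilon>\<bar> \<le> 2" by auto
  show "schwartz (weyl_remainder \<epsilon> N f g)" using assms \<epsilon> by (rule schwartz_weyl_remainder)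
  show "weyl_prod \<epsilon> f g X = (\<Sum>n = 0..N. of_real \<epsilon> ^ n * weyl_term n f g X) +
      of_real \<epsilon> ^ (N + 1) * weyl_remainder \<epsilon> N f g X"
    using assms \<epsilon>(1) by (rule weyl_prod_expansion)
next
  fix X
  \<comment> \<open>The explicit two-term formula is the case \<open>N = 1\<close> of the general
    estimate.\<close>
  have "f X * g X - of_real \<epsilon> * (\<i> / 2) * poisson_bracket f g X
      = (\<Sum>n = 0..1. of_real \<epsilon> ^ n * weyl_term n f g X)" for \<epsilon> :: real
    using weyl_term_1[OF assms, of X] by (simp add: weyl_term_0)
  then show "(\<lambda>\<epsilon>::real. weyl_prod \<epsilon> f g X - (f X * g X - of_real \<epsilon> * (\<i> / 2) * poisson_bracket f g X))
      \<in> O[at_right 0](\<lambda>\<epsilon>. of_real \<epsilon> ^ 2)"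
    using weyl_prod_bigo[OF assms, of X 1] by (simp only: one_add_one)
qed (intro schwartz_weyl_term weyl_prod_bigo weyl_term_0 weyl_term_1 assms)+

end
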